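(* (a) For every sequence $(a_0,a_1,a_2,\dots)$ of positive integers there exists an ordinary lattice R-irrational angle $\alpha$ with $\operatorname{ltan}\alpha=[a_0;a_1,a_2,\dots]$. (b) Two ordinary lattice R-irrational angles are lattice-congruent if and only if their lattice tangents are equal.
   Context: We work in $\mathbb R^2$ with lattice $\mathbb Z^2$. A lattice-affine transformation is $x\mapsto Mx+b$, $M\in GL_2(\mathbb Z)$, $b\in\mathbb Z^2$. $\operatorname{l\ell}(AB)$ is the number of lattice points on lattice segment $AB$ minus one. For an ordinary lattice angle $\angle XYZ$ ($X,Y,Z$ lattice points not collinear, rays $YX$, $YZ$): let $v_1,v_2$ be primitive lattice vectors along $YX$, $YZ$; lattice points $P$ with $(v_1,P-Y)$ a basis form two lines parallel to $YX$; ray $YZ$ meets exactly one, $l$, at $Q$; $D$ is the lattice point of $l$ nearest $Q$ among those strictly on the other side of line $YZ$ from $X$; writing $v_2=x_1v_1+x_2(D-Y)$, $\operatorname{lsin}\angle XYZ=x_2$. An angle $\angle AOB$ with lattice vertex $O$ ($O,A,B$ not collinear; ordered pair of rays $OA$, $OB$) is an ordinary lattice R-irrational angle if the open ray $OA$ contains lattice points and the open ray $OB$ contains none. Two such angles are lattice-congruent if a lattice-affine map sends vertex to vertex, ray $OA$ onto ray $O'A'$ and ray $OB$ onto ray $O'B'$. Sail: with $C$ the closed convex cone spanned by rays $OA$, $OB$ and $H$ the convex hull of $(C\cap\mathbb Z^2)\setminus\{O\}$, the sail is the closure of the intersection of the boundary of $H$ with the open cone; it is an infinite broken line oriented from $OA$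 toward $OB$ with vertices $V_0,V_1,\dots$ in order ($V_0$ on ray $OA$). $\operatorname{ltan}\angle AOB=[\operatorname{l\ell}(V_0V_1);\operatorname{lsin}\angle V_0V_1V_2,\operatorname{l\ell}(V_1V_2),\dots]$, where $[a_0;a_1,\dots]=\lim_{k\to\infty}[a_0;a_1,\dots,a_k]$. *)

theory Defs
  imports "HOL-Analysis.Analysis"
begin

definition int_lattice :: "(real^2) set" where
  "int_lattice = {x. \<forall>i. x $ i \<in> \<int>}"

definition lattice_affine :: "(real^2 \<Rightarrow> real^2) \<Rightarrow> bool" where
  "lattice_affine f \<longleftrightarrow>
     (\<exists>(M::int^2^2) b. invertible M \<and> b \<in> int_lattice \<and>
        f = (\<lambda>x. map_matrix of_int M *v x + b))"

definition ray :: "real^2 \<Rightarrow> real^2 \<Rightarrow> (real^2) set" where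
  "ray V A = {V + t *\<^sub>R (A - V) | t. 0 \<le> t}"

definition open_ray :: "real^2 \<Rightarrow> real^2 \<Rightarrow> (real^2) set" where
  "open_ray V A = {V + t *\<^sub>R (A - V) | t. 0 < t}"

definition lattice_length :: "real^2 \<Rightarrow> real^2 \<Rightarrow> nat" where
  "lattice_length A B = card (closed_segment A B \<inter> int_lattice) - 1"

definition primitive_along :: "real^2 \<Rightarrow> real^2 \<Rightarrow> real^2 \<Rightarrow> bool" where
  "primitive_along Y X v \<longleftrightarrow>
     v \<in> int_lattice \<and> lattice_length 0 v = 1 \<and> Y + v \<in> open_ray Y X"

definition lattice_basis :: "real^2 \<Rightarrow> real^2 \<Rightarrow> bool" where
  "lattice_basis u v \<longleftrightarrow> u \<in> int_lattice \<and> v \<in> int_lattice \<and>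
     (\<forall>w\<in>int_lattice. \<exists>!(m::int, n::int). w = of_int m *\<^sub>R u + of_int n *\<^sub>R v)"

definition strictly_opposite :: "real^2 \<Rightarrow> real^2 \<Rightarrow> real^2 \<Rightarrow> real^2 \<Rightarrow> bool" where
  "strictly_opposite Y Z X D \<longleftrightarrow>
     X \<notin> affine hull {Y, Z} \<and> D \<notin> affine hull {Y, Z} \<and>
     closed_segment X D \<inter> affine hull {Y, Z} \<noteq> {}"

text \<open>The point \<open>P\<close> only serves to select one of the two lines
  formed by the lattice points that complete \<open>v1\<close> to a basis.\<close>

definition lsin :: "real^2 \<Rightarrow> real^2 \<Rightarrow> real^2 \<Rightarrow> real" where
  "lsin X Y Z = (THE x2. \<exists>v1 v2 P l Q D x1.
     primitive_along Y X v1 \<and> primitive_along Y Z v2 \<and>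
     lattice_basis v1 (P - Y) \<and> l = {P + t *\<^sub>R v1 | t. True} \<and>
     Q \<in> l \<and> Q \<in> ray Y Z \<and>
     is_arg_min (dist Q) (\<lambda>D. D \<in> l \<and> D \<in> int_lattice \<and> strictly_opposite Y Z X D) D \<and>
     v2 = x1 *\<^sub>R v1 + x2 *\<^sub>R (D - Y))"

text \<open>An angle with vertex \<open>V\<close> and (ordered) rays \<open>VA\<close>, \<open>VB\<close> is
  represented by the points \<open>A\<close>, \<open>V\<close>, \<open>B\<close>; all notions below depend on
  \<open>A\<close> and \<open>B\<close> only through these rays.\<close>

definition R_irrational_angle :: "real^2 \<Rightarrow> real^2 \<Rightarrow> real^2 \<Rightarrow> bool" where
  "R_irrational_angle A V B \<longleftrightarrow>
     V \<in> int_lattice \<and> \<not> collinear {V, A, B} \<and>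
     open_ray V A \<inter> int_lattice \<noteq> {} \<and> open_ray V B \<inter> int_lattice = {}"

definition lattice_congruent ::
    "real^2 \<Rightarrow> real^2 \<Rightarrow> real^2 \<Rightarrow> real^2 \<Rightarrow> real^2 \<Rightarrow> real^2 \<Rightarrow> bool" where
  "lattice_congruent A V B A' V' B' \<longleftrightarrow>
     (\<exists>f. lattice_affine f \<and> f V = V' \<and>
        f ` ray V A = ray V' A' \<and> f ` ray V B = ray V' B')"

definition angle_cone :: "real^2 \<Rightarrow> real^2 \<Rightarrow> real^2 \<Rightarrow> (real^2) set" where
  "angle_cone A V B =
     {V + s *\<^sub>R (A - V) + t *\<^sub>R (B - V) | s t. 0 \<le> s \<and> 0 \<le> t}"

definition sail :: "real^2 \<Rightarrow> real^2 \<Rightarrow> real^2 \<Rightarrow> (real^2) set" where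
  "sail A V B =
     closure (frontier (convex hull ((angle_cone A V B \<inter> int_lattice) - {V}))
              \<inter> interior (angle_cone A V B))"

text \<open>Since consecutive edges are not collinear, the sequence cannot backtrack,
  so a sail together with its starting point on the ray \<open>VA\<close> determines the
  vertices and their order.\<close>

definition is_sail_vertices ::
    "real^2 \<Rightarrow> real^2 \<Rightarrow> real^2 \<Rightarrow> (nat \<Rightarrow> real^2) \<Rightarrow> bool" where
  "is_sail_vertices A V B W \<longleftrightarrow>
     W 0 \<in> ray V A \<and>
     sail A V B = (\<Union>i. closed_segment (W i) (W (i + 1))) \<and>
     (\<forall>i. \<not> collinear {W i, W (i + 1), W (i + 2)})"

definition sail_vertex :: "real^2 \<Rightarrow> real^2 \<Rightarrow> real^2 \<Rightarrow> nat \<Rightarrow> real^2" where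
  "sail_vertex A V B = (THE W. is_sail_vertices A V B W)"

fun fin_cfrac :: "(nat \<Rightarrow> real) \<Rightarrow> nat \<Rightarrow> real" where
  "fin_cfrac a 0 = a 0"
| "fin_cfrac a (Suc k) = a 0 + 1 / fin_cfrac (\<lambda>i. a (Suc i)) k"

definition inf_cfrac :: "(nat \<Rightarrow> real) \<Rightarrow> real" where
  "inf_cfrac a = lim (fin_cfrac a)"

definition ltan_seq :: "real^2 \<Rightarrow> real^2 \<Rightarrow> real^2 \<Rightarrow> nat \<Rightarrow> real" where
  "ltan_seq A V B n =
     (let W = sail_vertex A V B; i = n div 2 in
      if even n then real (lattice_length (W i) (W (i + 1)))
      else lsin (W i) (W (i + 1)) (W (i + 2)))"

definition ltan :: "real^2 \<Rightarrow> real^2 \<Rightarrow> real^2 \<Rightarrow> real" where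
  "ltan A V B = inf_cfrac (ltan_seq A V B)"

end

theory Submission
  imports Defs
begin

text \<open>
  A lattice-affine map brings every R-irrational angle into the position with vertex \<open>0\<close>, first ray
  through \<open>(1, 0)\<close> and second ray through \<open>(1, \<tau>)\<close>, where \<open>\<tau> > 1\<close> is irrational; it suffices to see
  that the lattice tangent of such an angle is \<open>\<tau>\<close>. Let \<open>p n / q n\<close> be the convergents of
  \<open>\<tau> = [a 0; a 1, ...]\<close>. The even ones give lattice points \<open>C i\<close> of the cone, and
  \<open>C (i + 1) = C i + a (2 i) e i\<close>, \<open>e (i + 1) = e i + a (2 i + 1) C (i + 1)\<close>, where \<open>e i\<close> comes from the
  odd ones. Since \<open>e i\<close> lies above the irrational ray, the linear form \<open>det (z, e i)\<close> is a positive
  integer on the nonzero lattice points of the cone, and it is \<open>1\<close> on the segment from \<open>C i\<close> to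
  \<open>C (i + 1)\<close>. These inequalities cut out the convex hull, so the sail is the broken line through the
  \<open>C i\<close>. Its lattice lengths are \<open>a (2 i)\<close> and its lattice sines are
  \<open>\<bar>det (e i, e (i + 1))\<bar> = a (2 i + 1)\<close>.
\<close>

section \<open>Determinants and lattice vectors\<close>

text \<open>The passage to the standard position rests on a basis \<open>e\<close>, \<open>w\<close>
  of the lattice with \<open>e\<close> along the first ray: the sign of \<open>w\<close> puts it on
  the side of the second ray, and adding a multiple of \<open>e\<close> to \<open>w\<close> makes
  the slope exceed 1. The bound 1 makes \<open>a 0\<close> positive, as in the sequences of (a).
  Equal tangents are then equal slopes, and (b) follows: a congruence composed with a normal form is
  a normal form of the other angle with the same slope, and two normal forms of equal slope compose
  to a congruence. Two obstacles shape the rest. The sail is infinite, so closedness of the broken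
  line and openness of the set beyond it do not come from finitely many half-planes; the second
  coordinate, which grows by at least 1 per vertex, cuts the problem into horizontal strips with one
  edge each. And \<open>lsin\<close> and \<open>sail_vertex\<close> are definite descriptions, so
  each value needs a uniqueness proof: any sequence of segments that fills the sail has to be shown
  to break exactly at the points \<open>C i\<close>.\<close>

definition cross :: "real^2 \<Rightarrow> real^2 \<Rightarrow> real" where
  "cross u v = u $ 1 * v $ 2 - u $ 2 * v $ 1"

lemma cross_linear:
  "cross (u + v) w = cross u w + cross v w" "cross w (u + v) = cross w u + cross w v"
  "cross (u - v) w = cross u w - cross v w" "cross w (u - v) = cross w u - cross w v"
  "cross (c *\<^sub>R u) w = c * cross u w" "cross w (c *\<^sub>R u) = c * cross w u"
  "cross (- u) w = - cross u w" "cross w (- u) = - cross w u"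
  by (simp_all add: cross_def algebra_simps)

lemma cross_self [simp]: "cross u u = 0" and cross_zero [simp]: "cross 0 u = 0" "cross u 0 = 0"
  by (simp_all add: cross_def)

lemma cross_skew: "cross u v = - cross v u"
  by (simp add: cross_def)

lemma vec2_eq_iff: "(u :: real^2) = v \<longleftrightarrow> u $ 1 = v $ 1 \<and> u $ 2 = v $ 2"
  by (simp add: vec_eq_iff forall_2)

text \<open>Cramer's rule with the denominator cleared, so that it also holds for dependent
  \<open>u\<close> and \<open>v\<close>.\<close>

lemma cross_expand: "cross u v *\<^sub>R w = cross w v *\<^sub>R u + cross u w *\<^sub>R v"
  by (simp add: vec2_eq_iff cross_def algebra_simps)

lemma cross_eq_0D:
  assumes "cross u v = 0" "u \<noteq> 0"
  shows "\<exists>c. v = c *\<^sub>R u"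
proof (cases "u $ 1 = 0")
  case True
  then have "u $ 2 \<noteq> 0" using assms(2) by (simp add: vec2_eq_iff)
  then show ?thesis using assms(1) True
    by (intro exI[of _ "v $ 2 / u $ 2"]) (auto simp: vec2_eq_iff cross_def field_simps)
next
  case False
  then show ?thesis using assms(1)
    by (intro exI[of _ "v $ 1 / u $ 1"]) (auto simp: vec2_eq_iff cross_def field_simps)
qed

lemma collinear_iff_cross: "collinear {a, b, c} \<longleftrightarrow> cross (b - a) (c - a) = 0"
proof -
  have "collinear {a, b, c} = collinear {b, a, c}" by (simp add: insert_commute)
  also have "\<dots> \<longleftrightarrow> collinear {0, b - a, c - a}"
    by (subst collinear_3[of b a c]) auto
  also have "\<dots> \<longleftrightarrow> cross (b - a) (c - a) = 0"
    unfolding collinear_lemma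
    using cross_eq_0D[of "b - a" "c - a"] by (auto simp: cross_linear(6))
  finally show ?thesis .
qed

lemma int_lattice_iff: "u \<in> int_lattice \<longleftrightarrow> u $ 1 \<in> \<int> \<and> u $ 2 \<in> \<int>"
  by (simp add: int_lattice_def forall_2)

lemma int_lattice_closed:
  "0 \<in> int_lattice"
  "u \<in> int_lattice \<Longrightarrow> v \<in> int_lattice \<Longrightarrow> u + v \<in> int_lattice"
  "u \<in> int_lattice \<Longrightarrow> v \<in> int_lattice \<Longrightarrow> u - v \<in> int_lattice"
  "u \<in> int_lattice \<Longrightarrow> - u \<in> int_lattice"
  "c \<in> \<int> \<Longrightarrow> u \<in> int_lattice \<Longrightarrow> c *\<^sub>R u \<in> int_lattice"
  by (simp_all add: int_lattice_iff)

lemma cross_int_lattice: "u \<in> int_lattice \<Longrightarrow> v \<in> int_lattice \<Longrightarrow> cross u v \<in> \<int>"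
  by (simp add: int_lattice_iff cross_def)

text \<open>Bezout's form of coprime coordinates. The witness \<open>w\<close> completes
  \<open>e\<close> to a lattice basis, and pairing with it reads off coefficients of
  \<open>e\<close> as integers.\<close>

definition primitive :: "real^2 \<Rightarrow> bool" where
  "primitive e \<longleftrightarrow> e \<in> int_lattice \<and> (\<exists>w\<in>int_lattice. cross e w = 1)"

lemma primitive_nonzero: "primitive e \<Longrightarrow> e \<noteq> 0"
  by (auto simp: primitive_def)

lemma primitive_uminus: "primitive e \<Longrightarrow> primitive (- e)"
  unfolding primitive_def
  by (metis cross_linear(7,8) int_lattice_closed(4) minus_minus)

lemma primitiveI:
  assumes "e \<in> int_lattice" "w \<in> int_lattice" "\<bar>cross e w\<bar> = 1"
  shows "primitive e"
proof -
  have "cross e w = 1 \<or> cross e (- w) = 1" using assms(3) by (auto simp: cross_linear)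
  then show ?thesis using assms int_lattice_closed(4) unfolding primitive_def by blast
qed

lemma primitive_scale_int:
  assumes "primitive e" shows "s *\<^sub>R e \<in> int_lattice \<longleftrightarrow> s \<in> \<int>"
proof
  assume "s *\<^sub>R e \<in> int_lattice"
  moreover obtain w where "w \<in> int_lattice" "cross e w = 1" using assms primitive_def by auto
  ultimately show "s \<in> \<int>" using cross_int_lattice[of "s *\<^sub>R e" w] by (simp add: cross_linear)
next
  assume "s \<in> \<int>" then show "s *\<^sub>R e \<in> int_lattice"
    using assms by (simp add: primitive_def int_lattice_closed)
qed

lemma lattice_length_primitive:
  assumes "primitive e" "Y \<in> int_lattice"
  shows "lattice_length Y (Y + real n *\<^sub>R e) = n"
proof -
  have "closed_segment Y (Y + real n *\<^sub>R e) \<inter> int_lattice = (\<lambda>k. Y + real k *\<^sub>R e) ` {..n}"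
    (is "?L = ?R")
  proof (intro equalityI subsetI)
    fix z assume z: "z \<in> ?L"
    then obtain u where u: "0 \<le> u" "u \<le> 1" "z = (1 - u) *\<^sub>R Y + u *\<^sub>R (Y + real n *\<^sub>R e)"
      by (auto simp: closed_segment_def)
    then have zz: "z = Y + (u * n) *\<^sub>R e" by (simp add: algebra_simps)
    then have "(u * n) *\<^sub>R e \<in> int_lattice" using z assms(2) int_lattice_closed(3)[of z Y] by auto
    then have "u * n \<in> \<int>" using primitive_scale_int[OF assms(1)] by blast
    then obtain k where k: "u * n = of_int k" by (auto elim: Ints_cases)
    have "0 \<le> u * n" "u * n \<le> n" using u by (auto simp: mult_left_le_one_le)
    then have "0 \<le> k" "k \<le> int n" using k by linarith+
    then show "z \<in> ?R" using zz k by (intro image_eqI[of _ _ "nat k"]) auto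
  next
    fix z assume "z \<in> ?R"
    then obtain k where k: "k \<le> n" "z = Y + real k *\<^sub>R e" by auto
    have "z \<in> int_lattice" using k assms by (auto simp: int_lattice_closed primitive_def)
    moreover have "z \<in> closed_segment Y (Y + real n *\<^sub>R e)"
    proof (cases "n = 0")
      case False
      then show ?thesis using k unfolding closed_segment_def
        by (auto intro!: exI[of _ "real k / real n"] simp: algebra_simps)
    qed (use k in auto)
    ultimately show "z \<in> ?L" by auto
  qed
  moreover have "inj_on (\<lambda>k. Y + real k *\<^sub>R e) {..n}"
    using primitive_nonzero[OF assms(1)] by (auto simp: inj_on_def)
  ultimately show ?thesis unfolding lattice_length_def by (simp add: card_image)
qed

text \<open>Pins down the vectors \<open>v1\<close> and \<open>v2\<close> in the definition of
  \<open>lsin\<close>.\<close>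

lemma primitive_along_iff:
  assumes "primitive e" "0 < c"
  shows "primitive_along Y (Y + c *\<^sub>R e) v \<longleftrightarrow> v = e"
proof
  assume v: "primitive_along Y (Y + c *\<^sub>R e) v"
  then obtain t where t: "0 < t" "v = (t * c) *\<^sub>R e"
    by (auto simp: primitive_along_def open_ray_def)
  then have "t * c \<in> \<int>" using v primitive_scale_int[OF assms(1)] by (simp add: primitive_along_def)
  then obtain k where k: "t * c = of_int k" by (auto elim: Ints_cases)
  have "0 < t * c" using t assms by auto
  then have "0 < k" using k by simp
  then have n: "v = 0 + real (nat k) *\<^sub>R e" using t k by simp
  then have "nat k = 1"
    using v lattice_length_primitive[OF assms(1) int_lattice_closed(1), of "nat k"]
    unfolding primitive_along_def by metis
  then show "v = e" using n by simp
next
  assume "v = e"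
  then show "primitive_along Y (Y + c *\<^sub>R e) v"
    using assms lattice_length_primitive[OF assms(1) int_lattice_closed(1), of 1]
    by (auto simp: primitive_along_def open_ray_def primitive_def intro!: exI[of _ "1 / c"])
qed

lemma int_mult_abs_1:
  assumes "x \<in> \<int>" "y \<in> \<int>" "x * y = (1::real)" shows "\<bar>y\<bar> = 1"
proof -
  obtain i j where ij: "x = of_int i" "y = of_int j" using assms by (auto elim!: Ints_cases)
  then have "i * j = 1" using assms(3) by (metis of_int_1 of_int_eq_iff of_int_mult)
  then show ?thesis using ij by (auto simp: zmult_eq_1_iff)
qed

lemma lattice_basis_iff:
  assumes "u \<in> int_lattice" "v \<in> int_lattice"
  shows "lattice_basis u v \<longleftrightarrow> \<bar>cross u v\<bar> = 1"
proof
  assume b: "lattice_basis u v"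
  have "\<exists>m n. w = of_int m *\<^sub>R u + of_int n *\<^sub>R v" if "w \<in> int_lattice" for w
  proof -
    have "\<exists>!(m::int, n::int). w = of_int m *\<^sub>R u + of_int n *\<^sub>R v"
      using b that unfolding lattice_basis_def by blast
    from ex1_implies_ex[OF this] show ?thesis by (simp only: split_paired_Ex prod.case)
  qed
  from this[of "vector [1, 0]"] this[of "vector [0, 1]"] obtain m n m' n' where
    e: "vector [1, 0] = of_int m *\<^sub>R u + of_int n *\<^sub>R v"
       "vector [0, 1] = of_int m' *\<^sub>R u + of_int n' *\<^sub>R v"
    by (auto simp: int_lattice_iff)
  \<comment> \<open>Expressing the standard basis through \<open>u\<close> and \<open>v\<close>
    multiplies the determinant by the integer \<open>m * n' - n * m'\<close>, so the integer
    \<open>cross u v\<close> divides 1.\<close>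
  have "cross (vector [1, 0]) (vector [0, 1]) = (of_int (m * n' - n * m')) * cross u v"
    unfolding e by (simp add: cross_linear algebra_simps cross_skew[of v u])
  then have "of_int (m * n' - n * m') * cross u v = 1" by (simp add: cross_def)
  then show "\<bar>cross u v\<bar> = 1"
    using int_mult_abs_1[OF Ints_of_int cross_int_lattice[OF assms]] by blast
next
  assume c: "\<bar>cross u v\<bar> = 1"
  show "lattice_basis u v" unfolding lattice_basis_def
  proof (intro conjI ballI assms)
    fix w assume w: "w \<in> int_lattice"
    \<comment> \<open>Being 1 or -1, \<open>\<delta>\<close> is its own inverse; multiplying by it
      replaces the division in Cramer's rule.\<close>
    define \<delta> where "\<delta> = cross u v"
    have d: "\<delta> * \<delta> = 1" "\<delta> \<in> \<int>" using c cross_int_lattice[OF assms]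
      unfolding \<delta>_def by (auto simp: abs_if split: if_splits)
    then have "\<delta> * cross w v \<in> \<int>" "\<delta> * cross u w \<in> \<int>"
      using assms w by (auto intro: Ints_mult cross_int_lattice)
    then obtain m n where mn: "\<delta> * cross w v = of_int m" "\<delta> * cross u w = of_int n"
      by (metis Ints_cases)
    have "(\<delta> * \<delta>) *\<^sub>R w = (\<delta> * cross w v) *\<^sub>R u + (\<delta> * cross u w) *\<^sub>R v"
      using arg_cong[OF cross_expand[of u v w], of "(*\<^sub>R) \<delta>"] unfolding \<delta>_def
      by (simp add: scaleR_add_right)
    then have ex: "w = of_int m *\<^sub>R u + of_int n *\<^sub>R v" using d mn by simp
    have "m' = m \<and> n' = n" if "w = of_int m' *\<^sub>R u + of_int n' *\<^sub>R v" for m' n'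
    proof -
      have "cross w v = of_int m' * \<delta>" "cross u w = of_int n' * \<delta>"
        unfolding that \<delta>_def by (simp_all add: cross_linear)
      then have "of_int m = real_of_int m' * (\<delta> * \<delta>)" "of_int n = real_of_int n' * (\<delta> * \<delta>)"
        using mn by (simp_all add: ac_simps)
      then show ?thesis using d by simp
    qed
    then show "\<exists>!(m, n). w = of_int m *\<^sub>R u + of_int n *\<^sub>R v" using ex by auto
  qed
qed

lemma affine_hull_2_iff_cross:
  assumes "Z \<noteq> Y" shows "D \<in> affine hull {Y, Z} \<longleftrightarrow> cross (Z - Y) (D - Y) = 0"
proof
  assume "D \<in> affine hull {Y, Z}"
  then obtain u v where "D = u *\<^sub>R Y + v *\<^sub>R Z" "u + v = 1" by (auto simp: affine_hull_2)
  then have "D = (1 - v) *\<^sub>R Y + v *\<^sub>R Z" by (simp add: eq_diff_eq)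
  then have "D - Y = v *\<^sub>R (Z - Y)" by (simp add: algebra_simps)
  then show "cross (Z - Y) (D - Y) = 0" by (simp add: cross_linear)
next
  assume "cross (Z - Y) (D - Y) = 0"
  then obtain c where "D - Y = c *\<^sub>R (Z - Y)" using cross_eq_0D assms by (metis right_minus_eq)
  then have "D = (1 - c) *\<^sub>R Y + c *\<^sub>R Z" by (simp add: algebra_simps)
  then show "D \<in> affine hull {Y, Z}" 
    unfolding affine_hull_2 by (intro CollectI exI[of _ "1 - c"] exI[of _ c]) simp
qed

text \<open>Along the segment from \<open>X\<close> to \<open>D\<close> the form
  \<open>cross (Z - Y) (_ - Y)\<close> is affine, so it has a zero between two nonzero end values
  exactly if these differ in sign.\<close>

lemma strictly_opposite_iff_cross:
  assumes "Z \<noteq> Y"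
  shows "strictly_opposite Y Z X D \<longleftrightarrow> cross (Z - Y) (X - Y) * cross (Z - Y) (D - Y) < 0"
proof -
  let ?x = "cross (Z - Y) (X - Y)" and ?d = "cross (Z - Y) (D - Y)"
  have seg: "cross (Z - Y) ((1 - u) *\<^sub>R X + u *\<^sub>R D - Y) = (1 - u) * ?x + u * ?d" for u
    by (simp add: cross_linear algebra_simps)
  have "(\<exists>u. 0 \<le> u \<and> u \<le> 1 \<and> (1 - u) * ?x + u * ?d = 0) \<longleftrightarrow> ?x * ?d < 0"
    if nz: "?x \<noteq> 0" "?d \<noteq> 0"
  proof
    assume "\<exists>u. 0 \<le> u \<and> u \<le> 1 \<and> (1 - u) * ?x + u * ?d = 0"
    then obtain u where u: "0 \<le> u" "u \<le> 1" "(1 - u) * ?x + u * ?d = 0" by auto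
    \<comment> \<open>Multiplying by \<open>?x\<close> makes the first summand nonnegative whatever
      the sign of \<open>?x\<close>, so the second one decides.\<close>
    have "(1 - u) * (?x * ?x) + u * (?x * ?d) = ?x * ((1 - u) * ?x + u * ?d)"
      by (simp add: algebra_simps)
    then have eq: "(1 - u) * (?x * ?x) + u * (?x * ?d) = 0" using u by simp
    have "u \<noteq> 0" using u nz by auto
    show "?x * ?d < 0"
    proof (rule ccontr)
      assume "\<not> ?x * ?d < 0"
      then have "0 < ?x * ?d" using nz by (simp add: less_le)
      then have "0 < u * (?x * ?d)" using u \<open>u \<noteq> 0\<close> by simp
      moreover have "0 \<le> (1 - u) * (?x * ?x)" using u by simp
      ultimately show False using eq by linarith
    qed
  next
    assume neg: "?x * ?d < 0"
    then have "0 \<le> ?x / (?x - ?d) \<and> ?x / (?x - ?d) \<le> 1 \<and> ?x - ?d \<noteq> 0"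
      by (auto simp: mult_less_0_iff divide_le_eq zero_le_divide_iff)
    moreover have "(1 - x / (x - d)) * x + x / (x - d) * d = 0" if "x - d \<noteq> 0" for x d :: real
      using that by (simp add: field_simps)
    ultimately show "\<exists>u. 0 \<le> u \<and> u \<le> 1 \<and> (1 - u) * ?x + u * ?d = 0" by blast
  qed
  moreover have "closed_segment X D \<inter> affine hull {Y, Z} \<noteq> {} \<longleftrightarrow>
      (\<exists>u. 0 \<le> u \<and> u \<le> 1 \<and> (1 - u) * ?x + u * ?d = 0)"
    by (auto simp: closed_segment_def affine_hull_2_iff_cross[OF assms] seg disjoint_iff)
  ultimately show ?thesis
    unfolding strictly_opposite_def affine_hull_2_iff_cross[OF assms]
    by (cases "?x = 0 \<or> ?d = 0") auto
qed

section \<open>The lattice sine as a determinant\<close>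

text \<open>On the line \<open>l\<close> the form \<open>cross e (_ - Y)\<close> is constantly 1 or
  -1; applying it to the expansion of \<open>e'\<close> in \<open>e\<close> and \<open>D - Y\<close>
  reads off \<open>x2\<close> up to sign, and \<open>Q\<close> on the ray fixes the sign. That the
  description is satisfied at all requires an explicit nearest lattice point
  \<open>D\<close>.\<close>

lemma lsin_eq_cross:
  assumes e: "primitive e" "0 < c" "primitive e'" "0 < c'"
    and Y: "Y \<in> int_lattice" and nz: "cross e e' \<noteq> 0"
  shows "lsin (Y + c *\<^sub>R e) Y (Y + c' *\<^sub>R e') = \<bar>cross e e'\<bar>"
proof -
  let ?X = "Y + c *\<^sub>R e" and ?Z = "Y + c' *\<^sub>R e'"
  let ?R = "\<lambda>v1 v2 P l Q D x1 x2.
     primitive_along Y ?X v1 \<and> primitive_along Y ?Z v2 \<and>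
     lattice_basis v1 (P - Y) \<and> l = {P + t *\<^sub>R v1 | t. True} \<and>
     Q \<in> l \<and> Q \<in> ray Y ?Z \<and>
     is_arg_min (dist Q) (\<lambda>D. D \<in> l \<and> D \<in> int_lattice \<and> strictly_opposite Y ?Z ?X D) D \<and>
     v2 = x1 *\<^sub>R v1 + x2 *\<^sub>R (D - Y)"
  note along = primitive_along_iff[OF e(1,2)] primitive_along_iff[OF e(3,4)]
  have eL: "e \<in> int_lattice" "e' \<in> int_lattice" using e by (auto simp: primitive_def)
  have ZY: "?Z \<noteq> Y" using primitive_nonzero[OF e(3)] e(4) by auto
  define \<epsilon> where "\<epsilon> = sgn (cross e e')"
  have eps: "\<bar>\<epsilon>\<bar> = 1" "\<epsilon> * \<epsilon> = 1" "\<epsilon> \<in> \<int>" "\<epsilon> * cross e e' = \<bar>cross e e'\<bar>"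
    using nz by (auto simp: \<epsilon>_def sgn_if)
  have unique: "x2 = \<bar>cross e e'\<bar>" if R: "?R v1 v2 P l Q D x1 x2" for v1 v2 P l Q D x1 x2
  proof -
    have v: "v1 = e" "v2 = e'" using R along by auto
    define \<delta> where "\<delta> = cross e (P - Y)"
    have bas: "lattice_basis e (P - Y)" using R v by auto
    then have "P - Y \<in> int_lattice" by (simp add: lattice_basis_def)
    then have d1: "\<bar>\<delta>\<bar> = 1" using bas lattice_basis_iff[OF eL(1)] \<delta>_def by blast
    have l: "l = {P + t *\<^sub>R e | t. True}" "Q \<in> l" "Q \<in> ray Y ?Z" "D \<in> l"
      using R v by (auto simp: is_arg_min_def)
    have on_l: "cross e (z - Y) = \<delta>" if "z \<in> l" for z
      using that l(1) by (auto simp: \<delta>_def cross_linear)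
    obtain t where t: "0 \<le> t" "Q - Y = t *\<^sub>R (c' *\<^sub>R e')" using l(3) by (auto simp: ray_def)
    have "\<delta> = t * c' * cross e e'" using on_l[OF l(2)] t by (simp add: cross_linear)
    moreover have "0 \<le> t * c'" using t e by simp
    ultimately have "\<delta> * cross e e' \<ge> 0"
      by (metis mult.assoc mult_nonneg_nonneg zero_le_square)
    then have "\<delta> * cross e e' = \<bar>cross e e'\<bar>" using d1 by (auto simp: abs_if split: if_splits)
    moreover have "cross e e' = x2 * \<delta>"
    proof -
      have "cross e e' = cross e (x1 *\<^sub>R e + x2 *\<^sub>R (D - Y))" using R v by metis
      then show ?thesis using on_l[OF l(4)] by (simp add: cross_linear(2,6))
    qed
    moreover have "\<delta> * \<delta> = 1" using d1 by (auto simp: abs_if split: if_splits)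
    ultimately show ?thesis by (metis mult.left_commute mult.right_neutral)
  qed
  obtain w0 where w0: "w0 \<in> int_lattice" "cross e w0 = 1" using e(1) by (auto simp: primitive_def)
  \<comment> \<open>Of the two candidate lines, the sign selects the one on the side of the ray
    along \<open>e'\<close>.\<close>
  define w where "w = \<epsilon> *\<^sub>R w0"
  have w: "w \<in> int_lattice" "cross e w = \<epsilon>"
    using w0 eps by (simp_all add: w_def int_lattice_closed cross_linear)
  define N where "N = \<bar>cross e e'\<bar>"
  have N: "N > 0" using nz N_def by simp
  define P where "P = Y + w"
  define l where "l = {P + t *\<^sub>R e | t. True}"
  \<comment> \<open>The scaling by \<open>1 / N\<close> gives
    \<open>cross e (Q - Y) = \<epsilon>\<close>, which puts \<open>Q\<close> on \<open>l\<close>.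
    The number \<open>k\<close> below is the position of \<open>Q\<close> on \<open>l\<close>,
    measured from \<open>P\<close> in units of \<open>e\<close>; the opposite side is then
    \<open>s < k\<close>.\<close>
  define Q where "Q = Y + (1 / N) *\<^sub>R e'"
  define k where "k = \<epsilon> / N * cross e' w"
  have cee: "cross e e' = \<epsilon> * N" using eps N_def by (simp add: \<epsilon>_def sgn_mult_abs)
  have Qk: "Q = P + k *\<^sub>R e"
  proof -
    have "cross e w *\<^sub>R e' = cross e' w *\<^sub>R e + cross e e' *\<^sub>R w" by (rule cross_expand)
    then have "\<epsilon> *\<^sub>R (\<epsilon> *\<^sub>R e') = \<epsilon> *\<^sub>R (cross e' w *\<^sub>R e + (\<epsilon> * N) *\<^sub>R w)"
      using w cee by simp
    then have "e' = (\<epsilon> * cross e' w) *\<^sub>R e + N *\<^sub>R w"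
      using eps by (simp add: scaleR_add_right flip: mult.assoc)
    then have "(1 / N) *\<^sub>R e' = (1 / N) *\<^sub>R ((\<epsilon> * cross e' w) *\<^sub>R e + N *\<^sub>R w)" by simp
    also have "\<dots> = k *\<^sub>R e + w" using N by (simp add: scaleR_add_right k_def)
    finally show ?thesis by (simp add: Q_def P_def)
  qed
  have opp: "strictly_opposite Y ?Z ?X (P + s *\<^sub>R e) \<longleftrightarrow> s < k" for s
  proof -
    have PQ: "P + s *\<^sub>R e - Y = (1 / N) *\<^sub>R e' + (s - k) *\<^sub>R e"
      using Qk by (simp add: Q_def algebra_simps)
    have "cross e' e = - \<epsilon> * N" using cee cross_skew[of e' e] by simp
    then have "cross (?Z - Y) (?X - Y) * cross (?Z - Y) (P + s *\<^sub>R e - Y)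
        = (c' * c' * c * (\<epsilon> * \<epsilon>) * N * N) * (s - k)"
      unfolding PQ by (simp add: cross_linear algebra_simps)
    also have "\<dots> < 0 \<longleftrightarrow> s < k"
      using e N eps by (simp add: mult_less_0_iff)
    finally show ?thesis using strictly_opposite_iff_cross[OF ZY] by simp
  qed
  have latt: "P + s *\<^sub>R e \<in> int_lattice \<longleftrightarrow> s \<in> \<int>" for s
  proof -
    have "P \<in> int_lattice" using Y w by (simp add: P_def int_lattice_closed)
    then have "P + s *\<^sub>R e \<in> int_lattice \<longleftrightarrow> s *\<^sub>R e \<in> int_lattice"
      by (metis add_diff_cancel_left' int_lattice_closed(2,3))
    then show ?thesis using primitive_scale_int[OF e(1)] by simp
  qed
  \<comment> \<open>The largest integer strictly below \<open>k\<close>; for integral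
    \<open>k\<close> this is \<open>k - 1\<close>, as \<open>Q\<close> itself lies on the line
    \<open>YZ\<close>.\<close>
  define m where "m = \<lceil>k\<rceil> - 1"
  define D where "D = P + of_int m *\<^sub>R e"
  have "is_arg_min (dist Q) (\<lambda>D. D \<in> l \<and> D \<in> int_lattice \<and> strictly_opposite Y ?Z ?X D) D"
    unfolding is_arg_min_linorder
  proof (intro conjI allI impI)
    show "D \<in> l" "D \<in> int_lattice" by (auto simp: l_def D_def latt)
    show "strictly_opposite Y ?Z ?X D" unfolding D_def opp m_def by linarith
    have dd: "dist Q (P + s *\<^sub>R e) = \<bar>k - s\<bar> * norm e" for s
      unfolding Qk dist_norm by (simp flip: scaleR_diff_left)
    fix y assume y: "y \<in> l \<and> y \<in> int_lattice \<and> strictly_opposite Y ?Z ?X y"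
    then obtain s where s: "y = P + s *\<^sub>R e" by (auto simp: l_def)
    then have "s \<in> \<int>" "s < k" using y latt opp by auto
    then obtain j where "s = of_int j" "of_int j < k" by (auto elim: Ints_cases)
    moreover have "j \<le> m" "of_int m < k"
      using \<open>of_int j < k\<close> unfolding m_def by (simp_all add: le_diff_eq less_ceiling_iff add1_zle_eq) linarith
    ultimately have "\<bar>k - of_int m\<bar> \<le> \<bar>k - s\<bar>" by linarith
    then show "dist Q D \<le> dist Q y" unfolding D_def s dd by (simp add: mult_right_mono)
  qed
  moreover have "lattice_basis e (P - Y)"
    using lattice_basis_iff[OF eL(1) w(1)] w eps by (simp add: P_def)
  moreover have "Q \<in> l" unfolding l_def Qk by auto
  moreover have "Q \<in> ray Y ?Z" using N e(4) unfolding ray_def Q_def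
    by (auto intro!: exI[of _ "1 / (N * c')"])
  moreover have "e' = (N * (k - of_int m)) *\<^sub>R e + N *\<^sub>R (D - Y)"
  proof -
    have "D - Y = (1 / N) *\<^sub>R e' + (of_int m - k) *\<^sub>R e"
      using Qk by (simp add: D_def Q_def algebra_simps)
    then have "N *\<^sub>R (D - Y) = e' + (N * (of_int m - k)) *\<^sub>R e"
      using N by (simp add: scaleR_add_right)
    then show ?thesis by (simp add: algebra_simps)
  qed
  ultimately have ex: "?R e e' P l Q D (N * (k - of_int m)) N"
    using along by (simp add: l_def)
  show ?thesis unfolding lsin_def
  proof (rule the_equality)
    show "\<exists>v1 v2 P l Q D x1. ?R v1 v2 P l Q D x1 \<bar>cross e e'\<bar>"
      using ex unfolding N_def by blast
  next
    fix x2 assume "\<exists>v1 v2 P l Q D x1. ?R v1 v2 P l Q D x1 x2"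
    then show "x2 = \<bar>cross e e'\<bar>" using unique by blast
  qed
qed

section \<open>Lattice-affine maps\<close>

definition lattice_linear :: "(real^2 \<Rightarrow> real^2) \<Rightarrow> bool" where
  "lattice_linear L \<longleftrightarrow> (\<exists>M::int^2^2. invertible M \<and> L = (\<lambda>x. map_matrix of_int M *v x))"

lemma map_matrix_of_int_mult:
  "map_matrix of_int ((M::int^2^2) ** N) = (map_matrix of_int M ** map_matrix of_int N :: real^2^2)"
  by (simp add: vec_eq_iff matrix_matrix_mult_def)

lemma map_matrix_of_int_1: "map_matrix of_int (mat 1 :: int^2^2) = (mat 1 :: real^2^2)"
  by (simp add: vec_eq_iff mat_def)

lemma lattice_affine_altdef:
  "lattice_affine f \<longleftrightarrow> (\<exists>L b. lattice_linear L \<and> b \<in> int_lattice \<and> f = (\<lambda>x. L x + b))"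
  unfolding lattice_affine_def lattice_linear_def by blast

lemma lattice_linear_linear: "lattice_linear L \<Longrightarrow> linear L"
  unfolding lattice_linear_def by auto

lemma lattice_linear_in_lattice:
  assumes "lattice_linear L" "x \<in> int_lattice" shows "L x \<in> int_lattice"
  using assms unfolding lattice_linear_def
  by (auto simp: int_lattice_def matrix_vector_mult_def intro!: Ints_sum)

lemma lattice_linear_inverse:
  assumes "lattice_linear L"
  obtains L' where "lattice_linear L'" "\<And>x. L (L' x) = x" "\<And>x. L' (L x) = x"
proof -
  obtain M :: "int^2^2" where M: "invertible M" "L = (\<lambda>x. map_matrix of_int M *v x)"
    using assms lattice_linear_def by auto
  then obtain N where N: "M ** N = mat 1" "N ** M = mat 1" by (auto simp: invertible_def)
  show ?thesis
  proof
    show "lattice_linear (\<lambda>x. map_matrix of_int N *v x)"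
      unfolding lattice_linear_def invertible_def using N by blast
  qed (simp_all add: M matrix_vector_mul_assoc N map_matrix_of_int_1 flip: map_matrix_of_int_mult)
qed

lemma lattice_linear_comp:
  assumes "lattice_linear L" "lattice_linear L'" shows "lattice_linear (\<lambda>x. L (L' x))"
proof -
  obtain M N :: "int^2^2" where "invertible M" "L = (\<lambda>x. map_matrix of_int M *v x)"
      "invertible N" "L' = (\<lambda>x. map_matrix of_int N *v x)"
    using assms unfolding lattice_linear_def by blast
  then have "invertible (M ** N)" "(\<lambda>x. L (L' x)) = (\<lambda>x. map_matrix of_int (M ** N) *v x)"
    by (simp_all add: invertible_mult matrix_vector_mul_assoc map_matrix_of_int_mult)
  then show ?thesis unfolding lattice_linear_def by blast
qed

lemma lattice_linear_cross:
  assumes "lattice_linear L" obtains \<delta> where "\<bar>\<delta>\<bar> = 1" "\<And>u v. cross (L u) (L v) = \<delta> * cross u v"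
proof -
  obtain M :: "int^2^2" where M: "invertible M" "L = (\<lambda>x. map_matrix of_int M *v x)"
    using assms lattice_linear_def by auto
  then obtain N where "M ** N = mat 1" by (auto simp: invertible_def)
  then have "det M * det N = 1" by (metis det_mul det_I)
  then have "\<bar>det M\<bar> = 1" by (auto simp: zmult_eq_1_iff)
  then have "\<bar>real_of_int (det M)\<bar> = 1" by linarith
  moreover have "cross (L u) (L v) = of_int (det M) * cross u v" for u v
    by (simp add: M cross_def matrix_vector_mult_def sum_2 det_2 algebra_simps)
  ultimately show ?thesis using that by blast
qed

lemma lattice_linear_basis:
  assumes "u \<in> int_lattice" "w \<in> int_lattice" "\<bar>cross u w\<bar> = 1"
  shows "lattice_linear (\<lambda>x. x $ 1 *\<^sub>R u + x $ 2 *\<^sub>R w)"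
proof -
  obtain a b c d where abcd: "u $ 1 = of_int a" "u $ 2 = of_int b" "w $ 1 = of_int c" "w $ 2 = of_int d"
    using assms by (auto simp: int_lattice_iff elim!: Ints_cases)
  define \<delta> where "\<delta> = a * d - b * c"
  have "real_of_int \<bar>\<delta>\<bar> = 1" using assms(3) unfolding cross_def abcd \<delta>_def by simp
  then have "\<bar>\<delta>\<bar> = 1" by linarith
  then have d: "\<delta> * \<delta> = 1" by (auto simp: abs_if split: if_splits)
  define M :: "int^2^2" where "M = vector [vector [a, c], vector [b, d]]"
  \<comment> \<open>The adjugate of \<open>M\<close> times its determinant \<open>\<delta>\<close>,
    which equals its own inverse.\<close>
  define N :: "int^2^2" where "N = vector [vector [\<delta> * d, - \<delta> * c], vector [- \<delta> * b, \<delta> * a]]"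
  have "M ** N = mat 1" "N ** M = mat 1" using d
    by (simp_all add: M_def N_def vec_eq_iff forall_2 matrix_matrix_mult_def sum_2 mat_def \<delta>_def algebra_simps)
  then have "invertible M" by (auto simp: invertible_def)
  moreover have "(\<lambda>x. x $ 1 *\<^sub>R u + x $ 2 *\<^sub>R w) = (\<lambda>x. map_matrix of_int M *v x)"
    by (auto simp: fun_eq_iff vec2_eq_iff matrix_vector_mult_def sum_2 M_def abcd)
  ultimately show ?thesis unfolding lattice_linear_def by blast
qed

lemma lattice_affine_comp:
  assumes "lattice_affine f" "lattice_affine g" shows "lattice_affine (f \<circ> g)"
proof -
  obtain L b L' b' where f: "lattice_linear L" "b \<in> int_lattice" "f = (\<lambda>x. L x + b)"
    and g: "lattice_linear L'" "b' \<in> int_lattice" "g = (\<lambda>x. L' x + b')"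
    using assms unfolding lattice_affine_altdef by blast
  have "f \<circ> g = (\<lambda>x. L (L' x) + (L b' + b))"
    by (simp add: f(3) g(3) fun_eq_iff linear_add[OF lattice_linear_linear[OF f(1)]])
  moreover have "L b' + b \<in> int_lattice"
    using f g by (simp add: int_lattice_closed lattice_linear_in_lattice)
  ultimately show ?thesis
    unfolding lattice_affine_altdef using lattice_linear_comp[OF f(1) g(1)] by blast
qed

lemma lattice_affine_inverse:
  assumes "lattice_affine f"
  obtains g where "lattice_affine g" "\<And>x. f (g x) = x" "\<And>x. g (f x) = x"
proof -
  obtain L b where f: "lattice_linear L" "b \<in> int_lattice" "f = (\<lambda>x. L x + b)"
    using assms unfolding lattice_affine_altdef by blast
  obtain L' where L': "lattice_linear L'" "\<And>x. L (L' x) = x" "\<And>x. L' (L x) = x"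
    using lattice_linear_inverse[OF f(1)] by metis
  define g where "g = (\<lambda>x. L' x + - L' b)"
  have "lattice_affine g" unfolding lattice_affine_altdef g_def
    using L'(1) f(2) int_lattice_closed(4) lattice_linear_in_lattice by blast
  moreover have "f (g x) = x" "g (f x) = x" for x
    using linear_add[OF lattice_linear_linear[OF f(1)]] linear_add[OF lattice_linear_linear[OF L'(1)]]
      linear_diff[OF lattice_linear_linear[OF f(1)]]
    by (simp_all add: f(3) g_def L')
  ultimately show ?thesis using that by blast
qed

lemma lattice_affine_bij:
  assumes "lattice_affine f" shows "bij f"
proof -
  obtain g where "\<And>x. f (g x) = x" "\<And>x. g (f x) = x"
    using lattice_affine_inverse[OF assms] by metis
  then show ?thesis by (metis bijI')
qed

lemma lattice_affine_in_lattice: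
  assumes "lattice_affine f" "x \<in> int_lattice" shows "f x \<in> int_lattice"
proof -
  obtain L b where f: "lattice_linear L" "b \<in> int_lattice" "f = (\<lambda>x. L x + b)"
    using assms(1) unfolding lattice_affine_altdef by blast
  then show ?thesis using int_lattice_closed(2)[OF lattice_linear_in_lattice[OF f(1) assms(2)]] by simp
qed

lemma lattice_affine_image_lattice:
  assumes "lattice_affine f" shows "f ` int_lattice = int_lattice"
proof -
  obtain g where g: "lattice_affine g" "\<And>x. f (g x) = x"
    using lattice_affine_inverse[OF assms] by metis
  have "x \<in> f ` int_lattice" if "x \<in> int_lattice" for x
    using g lattice_affine_in_lattice[OF g(1) that] by (metis image_eqI)
  then show ?thesis using lattice_affine_in_lattice[OF assms] by blast
qed

text \<open>A translate of an injective linear image is the form to which the library facts on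
  hulls, interiors and closures apply.\<close>

lemma lattice_affine_decompose:
  assumes "lattice_affine f"
  obtains L b where "linear L" "inj L" "\<And>x. f x = b + L x" "\<And>S. f ` S = (+) b ` (L ` S)"
proof -
  obtain L b where f: "lattice_linear L" "f = (\<lambda>x. L x + b)"
    using assms unfolding lattice_affine_altdef by blast
  have "inj L" using lattice_linear_inverse[OF f(1)] by (metis injI)
  then show ?thesis
    using that[of L b] f lattice_linear_linear by (auto simp: image_image add.commute)
qed

lemma lattice_affine_diff:
  assumes "lattice_affine f"
  obtains L where "lattice_linear L" "\<And>x y. f x - f y = L (x - y)"
proof -
  obtain L b where f: "lattice_linear L" "f = (\<lambda>x. L x + b)"
    using assms unfolding lattice_affine_altdef by blast
  then show ?thesis using that[of L] linear_diff[OF lattice_linear_linear[OF f(1)]] by auto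
qed

lemma lattice_affine_image_convex_hull:
  assumes "lattice_affine f" shows "f ` (convex hull S) = convex hull (f ` S)"
proof -
  obtain L b where "linear L" "inj L" "\<And>S. f ` S = (+) b ` (L ` S)"
    using lattice_affine_decompose[OF assms] by metis
  then show ?thesis by (simp add: convex_hull_linear_image convex_hull_translation)
qed

lemma lattice_affine_image_interior:
  assumes "lattice_affine f" shows "f ` interior S = interior (f ` S)"
proof -
  obtain L b where "linear L" "inj L" "\<And>S. f ` S = (+) b ` (L ` S)"
    using lattice_affine_decompose[OF assms] by metis
  then show ?thesis by (simp add: interior_injective_linear_image interior_translation)
qed

lemma lattice_affine_image_closure:
  assumes "lattice_affine f" shows "f ` closure S = closure (f ` S)"
proof -
  obtain L b where "linear L" "inj L" "\<And>S. f ` S = (+) b ` (L ` S)"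
    using lattice_affine_decompose[OF assms] by metis
  then show ?thesis by (simp add: closure_injective_linear_image closure_translation)
qed

lemma lattice_affine_image_frontier:
  assumes "lattice_affine f" shows "f ` frontier S = frontier (f ` S)"
  using lattice_affine_bij[OF assms]
  by (simp add: frontier_def image_set_diff bij_is_inj
      lattice_affine_image_interior[OF assms] lattice_affine_image_closure[OF assms])

lemma lattice_affine_image_segment:
  assumes "lattice_affine f" shows "f ` closed_segment x y = closed_segment (f x) (f y)"
proof -
  obtain L b where "linear L" "\<And>x. f x = b + L x" "\<And>S. f ` S = (+) b ` (L ` S)"
    using lattice_affine_decompose[OF assms] by metis
  then show ?thesis
    using closed_segment_linear_image[of L x y] closed_segment_translation[of b "L x" "L y"] by simp
qed

lemma lattice_affine_image_ray:
  assumes "lattice_affine f" shows "f ` ray V A = ray (f V) (f A)"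
proof -
  obtain L b where L: "linear L" "\<And>x. f x = b + L x"
    using lattice_affine_decompose[OF assms] by metis
  have "f (V + t *\<^sub>R (A - V)) = f V + t *\<^sub>R (f A - f V)" for t
    using L by (simp add: linear_add linear_diff linear_scale)
  then show ?thesis unfolding ray_def by (fastforce simp: image_def)
qed

lemma lattice_affine_collinear:
  assumes "lattice_affine f" shows "collinear {f x, f y, f z} \<longleftrightarrow> collinear {x, y, z}"
proof -
  obtain L where L: "lattice_linear L" "\<And>x y. f x - f y = L (x - y)"
    using lattice_affine_diff[OF assms] by metis
  obtain \<delta> where "\<bar>\<delta>\<bar> = 1" "\<And>u v. cross (L u) (L v) = \<delta> * cross u v"
    using lattice_linear_cross[OF L(1)] by metis
  then show ?thesis by (auto simp: collinear_iff_cross L)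
qed

section \<open>Cones, sails and sail vertices under lattice-affine maps\<close>

lemma rayI: "0 \<le> t \<Longrightarrow> V + t *\<^sub>R (A - V) \<in> ray V A"
  unfolding ray_def by blast

lemma rayE: assumes "z \<in> ray V A" obtains t where "0 \<le> t" "z = V + t *\<^sub>R (A - V)"
  using assms unfolding ray_def by blast

text \<open>A congruence controls the rays only as sets, not the points \<open>A\<close> and
  \<open>B\<close> on them, so the cone has to be described through the rays.\<close>

lemma angle_cone_rays: "angle_cone A V B = {a + b - V | a b. a \<in> ray V A \<and> b \<in> ray V B}"
proof (intro equalityI subsetI)
  fix z assume "z \<in> angle_cone A V B"
  then obtain s t where st: "0 \<le> s" "0 \<le> t" "z = V + s *\<^sub>R (A - V) + t *\<^sub>R (B - V)"
    unfolding angle_cone_def by blast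
  show "z \<in> {a + b - V | a b. a \<in> ray V A \<and> b \<in> ray V B}"
  proof (intro CollectI exI conjI)
    show "z = (V + s *\<^sub>R (A - V)) + (V + t *\<^sub>R (B - V)) - V" using st by simp
  qed (use st in \<open>simp_all add: rayI\<close>)
next
  fix z assume "z \<in> {a + b - V | a b. a \<in> ray V A \<and> b \<in> ray V B}"
  then obtain a b where "z = a + b - V" "a \<in> ray V A" "b \<in> ray V B" by blast
  moreover from this obtain s where s: "0 \<le> s" "a = V + s *\<^sub>R (A - V)" by (blast elim: rayE)
  moreover from calculation obtain t where t: "0 \<le> t" "b = V + t *\<^sub>R (B - V)" by (blast elim: rayE)
  ultimately have st: "0 \<le> s" "0 \<le> t" "z = (V + s *\<^sub>R (A - V)) + (V + t *\<^sub>R (B - V)) - V" by auto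
  show "z \<in> angle_cone A V B" unfolding angle_cone_def
  proof (intro CollectI exI conjI)
    show "z = V + s *\<^sub>R (A - V) + t *\<^sub>R (B - V)" using st by simp
  qed fact+
qed

lemma lattice_affine_image_angle_cone:
  assumes "lattice_affine f" "f V = V'" "f ` ray V A = ray V' A'" "f ` ray V B = ray V' B'"
  shows "f ` angle_cone A V B = angle_cone A' V' B'"
proof -
  obtain L c where L: "linear L" "\<And>x. f x = c + L x"
    using lattice_affine_decompose[OF assms(1)] by metis
  have "f (a + b - V) = f a + f b - V'" for a b
    using L by (simp add: assms(2)[symmetric] linear_add linear_diff)
  then show ?thesis
    unfolding angle_cone_rays assms(3,4)[symmetric] by (fastforce simp: image_def)
qed

lemma lattice_affine_image_sail:
  assumes "lattice_affine f" "f V = V'" "f ` ray V A = ray V' A'" "f ` ray V B = ray V' B'"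
  shows "f ` sail A V B = sail A' V' B'"
proof -
  note inj = bij_is_inj[OF lattice_affine_bij[OF assms(1)]]
  show ?thesis
    unfolding sail_def
    by (simp add: lattice_affine_image_closure lattice_affine_image_frontier image_Int[OF inj]
      lattice_affine_image_interior lattice_affine_image_convex_hull image_set_diff[OF inj]
      lattice_affine_image_angle_cone[OF assms] lattice_affine_image_lattice assms(1,2))
qed

lemma is_sail_vertices_lattice_affine:
  assumes "lattice_affine f" "f V = V'" "f ` ray V A = ray V' A'" "f ` ray V B = ray V' B'"
  shows "is_sail_vertices A' V' B' (f \<circ> W) \<longleftrightarrow> is_sail_vertices A V B W"
proof -
  note inj = bij_is_inj[OF lattice_affine_bij[OF assms(1)]]
  have "f (W 0) \<in> ray V' A' \<longleftrightarrow> W 0 \<in> ray V A"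
    using inj_image_mem_iff[OF inj] assms(3) by metis
  moreover have "(\<Union>i. closed_segment (f (W i)) (f (W (i + 1)))) = f ` (\<Union>i. closed_segment (W i) (W (i + 1)))"
    by (simp add: image_UN lattice_affine_image_segment[OF assms(1)])
  ultimately show ?thesis
    unfolding is_sail_vertices_def lattice_affine_image_sail[OF assms, symmetric] o_def
    by (simp add: inj_image_eq_iff[OF inj] lattice_affine_collinear[OF assms(1)])
qed

text \<open>Transports the definite description: a second vertex sequence of the image angle pulls
  back along the inverse of \<open>f\<close>, where uniqueness is assumed.\<close>

lemma sail_vertex_lattice_affine:
  assumes "lattice_affine f" "f V = V'" "f ` ray V A = ray V' A'" "f ` ray V B = ray V' B'"
    and W: "is_sail_vertices A V B W" "\<And>W'. is_sail_vertices A V B W' \<Longrightarrow> W' = W"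
  shows "sail_vertex A' V' B' = f \<circ> W"
  unfolding sail_vertex_def
proof (rule the_equality)
  show "is_sail_vertices A' V' B' (f \<circ> W)"
    using is_sail_vertices_lattice_affine[OF assms(1-4)] W by blast
  fix W' assume W': "is_sail_vertices A' V' B' W'"
  obtain g where g: "\<And>x. f (g x) = x" using lattice_affine_inverse[OF assms(1)] by metis
  then have eq: "W' = f \<circ> (g \<circ> W')" by auto
  then have "g \<circ> W' = W" using W' W(2) is_sail_vertices_lattice_affine[OF assms(1-4)] by metis
  then show "W' = f \<circ> W" using eq by simp
qed

section \<open>Continued fractions\<close>

text \<open>Indices are shifted by two against the usual ones: \<open>cf_num a (n + 2) / cf_den a (n + 2)\<close> is the
  \<open>n\<close>-th convergent. The two extra initial terms give the vertex on the rational ray.\<close>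

fun cf_num :: "(nat \<Rightarrow> nat) \<Rightarrow> nat \<Rightarrow> int" where
  "cf_num a 0 = 0"
| "cf_num a (Suc 0) = 1"
| "cf_num a (Suc (Suc n)) = int (a n) * cf_num a (Suc n) + cf_num a n"

fun cf_den :: "(nat \<Rightarrow> nat) \<Rightarrow> nat \<Rightarrow> int" where
  "cf_den a 0 = 1"
| "cf_den a (Suc 0) = 0"
| "cf_den a (Suc (Suc n)) = int (a n) * cf_den a (Suc n) + cf_den a n"

text \<open>\<open>fin_cfrac\<close> recurses at the front of the sequence, \<open>cf_num\<close>
  and \<open>cf_den\<close> at its end. This lemma and the next bridge the two by relating a
  fraction to that of its tail.\<close>

lemma cf_den_shift: "cf_den a (Suc k) = cf_num (\<lambda>i. a (Suc i)) k"
  by (induction k rule: induct_nat_012) auto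

lemma cf_num_shift:
  "cf_num a (Suc k) = int (a 0) * cf_num (\<lambda>i. a (Suc i)) k + cf_den (\<lambda>i. a (Suc i)) k"
proof (induction k rule: induct_nat_012)
  case (ge2 n)
  let ?p = "cf_num (\<lambda>i. a (Suc i))" and ?q = "cf_den (\<lambda>i. a (Suc i))"
  have "cf_num a (Suc (Suc (Suc n))) = int (a (Suc n)) * cf_num a (Suc (Suc n)) + cf_num a (Suc n)"
    by (rule cf_num.simps)
  also have "\<dots> = int (a 0) * (int (a (Suc n)) * ?p (Suc n) + ?p n)
      + (int (a (Suc n)) * ?q (Suc n) + ?q n)"
    unfolding ge2 by (simp only: algebra_simps)
  finally show ?case by simp
qed auto

lemma cf_den_nonneg: "0 \<le> cf_den a n"
  by (induction a n rule: cf_den.induct) auto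

lemma cf_num_nonneg: "0 \<le> cf_num a n"
  by (induction a n rule: cf_num.induct) auto

lemma cf_num_Suc_pos:
  assumes "\<And>n. 0 < a n" shows "0 < cf_num a (Suc n)"
proof (induction n)
  case (Suc n)
  then show ?case using assms[of n] cf_num_nonneg[of a n] by (auto intro!: add_pos_nonneg)
qed auto

lemma cf_den_pos:
  assumes "\<And>n. 0 < a n" shows "0 < cf_den a (Suc (Suc n))"
  using cf_num_Suc_pos[of "\<lambda>i. a (Suc i)" n] assms by (simp add: cf_den_shift del: cf_den.simps)

text \<open>Each denominator exceeds the preceding one by at least the one before that, which is at
  least 1. Linear growth suffices for the limits below.\<close>

lemma cf_den_ge:
  assumes "\<And>n. 0 < a n" shows "int n \<le> cf_den a (Suc (Suc n))"
proof (induction n rule: less_induct)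
  case (less n)
  consider "n = 0" | "n = 1" | m where "n = Suc (Suc m)" by (metis One_nat_def not0_implies_Suc)
  then show ?case
  proof cases
    case 1 then show ?thesis using cf_den_nonneg by simp
  next
    case 2 then show ?thesis using cf_den_pos[of a, OF assms, of 1] by simp
  next
    case (3 m)
    have "int (Suc m) \<le> cf_den a (Suc (Suc (Suc m)))" using less.IH[of "Suc m"] 3 by simp
    also have "\<dots> \<le> int (a (Suc (Suc m))) * cf_den a (Suc (Suc (Suc m)))"
      using assms[of "Suc (Suc m)"] cf_den_nonneg[of a "Suc (Suc (Suc m))"]
      by (simp add: mult_le_cancel_right1 del: cf_den.simps)
    finally have "int (Suc m) + 1 \<le> int (a (Suc (Suc m))) * cf_den a (Suc (Suc (Suc m))) + cf_den a (Suc (Suc m))"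
      using cf_den_pos[of a, OF assms, of m] by linarith
    also have "\<dots> = cf_den a (Suc (Suc n))" unfolding 3 by (rule cf_den.simps(3)[symmetric])
    finally show ?thesis using 3 by simp
  qed
qed

lemma fin_cfrac_conv:
  assumes "\<And>n. 0 < a n"
  shows "fin_cfrac (\<lambda>n. real (a n)) n = of_int (cf_num a (Suc (Suc n))) / of_int (cf_den a (Suc (Suc n)))"
  using assms
proof (induction n arbitrary: a)
  case (Suc n)
  let ?a = "\<lambda>i. a (Suc i)"
  have "0 < cf_num ?a (Suc (Suc n))" using cf_num_Suc_pos[of ?a] Suc.prems by blast
  then have nz: "real_of_int (cf_num ?a (Suc (Suc n))) \<noteq> 0"
    by (simp del: cf_num.simps)
  have "fin_cfrac (\<lambda>n. real (a n)) (Suc n)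
      = a 0 + of_int (cf_den ?a (Suc (Suc n))) / of_int (cf_num ?a (Suc (Suc n)))"
    using Suc.IH[of ?a] Suc.prems by (simp del: cf_num.simps cf_den.simps)
  also have "\<dots> = of_int (cf_num a (Suc (Suc (Suc n)))) / of_int (cf_den a (Suc (Suc (Suc n))))"
    unfolding cf_num_shift[of a "Suc (Suc n)"] cf_den_shift[of a "Suc (Suc n)"]
    using nz by (simp add: field_simps del: cf_num.simps cf_den.simps)
  finally show ?case .
qed auto

lemma cf_det: "cf_den a n * cf_num a (Suc n) - cf_num a n * cf_den a (Suc n) = (- 1) ^ n"
proof (induction n)
  case (Suc n)
  have "cf_den a (Suc n) * cf_num a (Suc (Suc n)) - cf_num a (Suc n) * cf_den a (Suc (Suc n))
      = - (cf_den a n * cf_num a (Suc n) - cf_num a n * cf_den a (Suc n))"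
    by (simp add: algebra_simps)
  then show ?case using Suc by (simp del: cf_num.simps cf_den.simps)
qed simp

lemma cf_den_mono:
  assumes "\<And>n. 0 < a n" shows "cf_den a (Suc (Suc n)) \<le> cf_den a (Suc (Suc (Suc n)))"
proof -
  have "cf_den a (Suc (Suc n)) \<le> int (a (Suc n)) * cf_den a (Suc (Suc n))"
    using assms[of "Suc n"] cf_den_nonneg[of a "Suc (Suc n)"]
    by (simp add: mult_le_cancel_right1 del: cf_den.simps)
  then show ?thesis using cf_den_nonneg[of a "Suc n"] cf_den.simps(3)[of a "Suc n"] by linarith
qed

lemma inverse_cf_den_tendsto_0:
  assumes "\<And>n. 0 < a n" shows "(\<lambda>n. 1 / real_of_int (cf_den a (Suc (Suc n)))) \<longlonglongrightarrow> 0"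
proof (rule tendsto_sandwich[OF _ _ tendsto_const lim_1_over_n])
  have pos: "0 < real_of_int (cf_den a (Suc (Suc n)))" for n
    using cf_den_pos[of a, OF assms] by (simp del: cf_den.simps)
  then show "\<forall>\<^sub>F n in sequentially. 0 \<le> 1 / real_of_int (cf_den a (Suc (Suc n)))"
    by (intro always_eventually allI divide_nonneg_pos) auto
  have "real n \<le> real_of_int (cf_den a (Suc (Suc n)))" for n
    using cf_den_ge[of a, OF assms, of n] by linarith
  then show "\<forall>\<^sub>F n in sequentially. 1 / real_of_int (cf_den a (Suc (Suc n))) \<le> 1 / real n"
    using pos by (intro eventually_mono[OF eventually_gt_at_top[of 0]] divide_left_mono mult_pos_pos) auto
qed

lemma fin_cfrac_diff:
  assumes "\<And>n. 0 < a n"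
  shows "fin_cfrac (\<lambda>n. real (a n)) (Suc n) - fin_cfrac (\<lambda>n. real (a n)) n
    = (- 1) ^ n * (1 / (of_int (cf_den a (Suc (Suc n))) * of_int (cf_den a (Suc (Suc (Suc n))))))"
proof -
  define p q p' q' where d: "p = real_of_int (cf_num a (Suc (Suc n)))" "q = real_of_int (cf_den a (Suc (Suc n)))"
    "p' = real_of_int (cf_num a (Suc (Suc (Suc n))))" "q' = real_of_int (cf_den a (Suc (Suc (Suc n))))"
  have "q > 0" "q' > 0" unfolding d using cf_den_pos[of a, OF assms] by (simp_all del: cf_den.simps)
  moreover have "q * p' - p * q' = (- 1) ^ n"
    unfolding d using arg_cong[OF cf_det[of a "Suc (Suc n)"], of real_of_int]
    by (simp del: cf_den.simps cf_num.simps)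
  ultimately show ?thesis unfolding fin_cfrac_conv[of a, OF assms] d[symmetric]
    by (simp add: field_simps)
qed

text \<open>The differences of consecutive convergents alternate in sign and decrease to 0 in
  absolute value, so Leibniz' criterion applies to their telescoping sum.\<close>

lemma convergent_fin_cfrac:
  assumes "\<And>n. 0 < a n" shows "convergent (fin_cfrac (\<lambda>n. real (a n)))"
proof -
  let ?f = "fin_cfrac (\<lambda>n. real (a n))"
  define q where "q n = real_of_int (cf_den a (Suc (Suc n)))" for n
  have q: "0 < q n" "q n \<le> q (Suc n)" for n
    using cf_den_pos[of a, OF assms, of n] cf_den_mono[of a, OF assms, of n] unfolding q_def by linarith+
  have q0: "(\<lambda>n. 1 / q n) \<longlonglongrightarrow> 0" unfolding q_def by (rule inverse_cf_den_tendsto_0[of a, OF assms])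
  have "(\<lambda>n. 1 / q n * (1 / q (Suc n))) \<longlonglongrightarrow> 0 * 0"
    by (intro tendsto_mult q0 LIMSEQ_Suc[OF q0])
  then have l: "(\<lambda>n. 1 / (q n * q (Suc n))) \<longlonglongrightarrow> 0" by simp
  have "summable (\<lambda>n. (- 1) ^ n * (1 / (q n * q (Suc n))))"
  proof (rule summable_Leibniz'(1)[OF l])
    show "0 \<le> 1 / (q n * q (Suc n))" for n using q(1)[of n] q(1)[of "Suc n"] by simp
    show "1 / (q (Suc n) * q (Suc (Suc n))) \<le> 1 / (q n * q (Suc n))" for n
      using q(1)[of n] q(1)[of "Suc n"] q(1)[of "Suc (Suc n)"] q(2)[of n] q(2)[of "Suc n"]
      by (intro divide_left_mono mult_mono mult_pos_pos) auto
  qed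
  then have "summable (\<lambda>n. ?f (Suc n) - ?f n)"
    unfolding fin_cfrac_diff[of a, OF assms] q_def .
  then have "convergent (\<lambda>n. \<Sum>k<n. ?f (Suc k) - ?f k)" by (simp add: summable_iff_convergent)
  then have "convergent (\<lambda>n. ?f n - ?f 0)" by (simp only: sum_lessThan_telescope)
  then show ?thesis using convergent_diff_const_right_iff by blast
qed

text \<open>The numbers \<open>t n\<close> are the complete quotients. Keeping them as a parameter
  lets the locale serve both a prescribed sequence and a prescribed irrational number.\<close>

locale cfrac_expansion =
  fixes a :: "nat \<Rightarrow> nat" and t :: "nat \<Rightarrow> real"
  assumes a_pos: "\<And>n. 0 < a n" and t_gt_1: "\<And>n. 1 < t n"
    and t_rec: "\<And>n. t n = a n + 1 / t (Suc n)"
begin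

abbreviation "\<tau> \<equiv> t 0"

text \<open>Positive exactly if the point with coordinates \<open>cf_den a n\<close> and
  \<open>cf_num a n\<close> lies below the line of slope \<open>\<tau>\<close>; its sign tells
  vertices from edge directions.\<close>

definition err :: "nat \<Rightarrow> real" where "err n = \<tau> * of_int (cf_den a n) - of_int (cf_num a n)"

text \<open>\<open>err\<close> is linear in numerator and denominator and so obeys their three-term
  recurrence; the equation for \<open>t n\<close> collapses it to a two-term one, from which
  alternation and decay are read off.\<close>

lemma err_rec: "err n = - t n * err (Suc n)"
proof (induction n)
  case 0 then show ?case by (simp add: err_def)
next
  case (Suc n)
  have "err (Suc (Suc n)) = a n * err (Suc n) + err n" by (simp add: err_def algebra_simps)
  also have "\<dots> = - (1 / t (Suc n)) * err (Suc n)" using Suc t_rec[of n] by (simp add: algebra_simps)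
  finally show ?case using t_gt_1[of "Suc n"] by simp
qed

lemma err_sign: "0 < (- 1) ^ n * err n"
proof (induction n)
  case 0 then show ?case using t_gt_1[of 0] by (simp add: err_def)
next
  case (Suc n)
  have "(- 1) ^ n * err n = t n * ((- 1) ^ Suc n * err (Suc n))" using err_rec[of n] by simp
  then show ?case using Suc t_gt_1[of n]
    by (metis less_trans zero_less_mult_pos zero_less_one)
qed

lemma err_even: "0 < err (2 * i)" and err_odd: "err (2 * i + 1) < 0"
  using err_sign[of "2 * i"] err_sign[of "2 * i + 1"] by (auto simp: mult_less_0_iff)

lemma abs_err_less: "\<bar>err (Suc n)\<bar> < \<bar>err n\<bar>"
proof -
  have "err (Suc n) \<noteq> 0" using err_sign[of "Suc n"] by auto
  then show ?thesis using err_rec[of n] t_gt_1[of n] by (simp add: abs_mult)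
qed

lemma abs_err_le: "\<bar>err (Suc n)\<bar> \<le> 1"
proof (induction n)
  case (Suc n) then show ?case using abs_err_less[of "Suc n"] by simp
qed (simp add: err_def)

text \<open>For \<open>\<tau> = r / s\<close> the numbers \<open>s * \<bar>err n\<bar>\<close> would be a strictly decreasing sequence of
  natural numbers.\<close>

lemma irrational: "\<tau> \<notin> \<rat>"
proof
  assume "\<tau> \<in> \<rat>"
  then obtain r s where rs: "s > 0" "\<tau> = of_int r / of_int s" by (auto elim: Rats_cases')
  define k where "k n = nat \<bar>r * cf_den a n - s * cf_num a n\<bar>" for n
  have k: "real (k n) = of_int s * \<bar>err n\<bar>" for n
  proof -
    have "of_int (r * cf_den a n - s * cf_num a n) = of_int s * err n"
      using rs by (simp add: err_def field_simps)
    then show ?thesis using rs(1) unfolding k_def by (simp add: abs_mult)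
  qed
  have "real (k (Suc n)) < real (k n)" for n
    unfolding k using abs_err_less[of n] rs(1) by simp
  then have "k (Suc n) < k n" for n by simp
  then show False using wf_less wf_iff_no_infinite_down_chain[of "{(x, y). x < (y::nat)}"] by blast
qed

text \<open>A convergent misses \<open>\<tau>\<close> by \<open>err\<close> over its denominator;
  the former is bounded by 1, the latter tends to infinity.\<close>

lemma inf_cfrac_eq: "inf_cfrac (\<lambda>n. real (a n)) = \<tau>"
proof -
  let ?q = "\<lambda>n. real_of_int (cf_den a (Suc (Suc n)))"
  have "norm (fin_cfrac (\<lambda>n. real (a n)) n - \<tau>) \<le> 1 / ?q n" for n
  proof -
    have q: "0 < ?q n" using cf_den_pos[of a, OF a_pos] by (simp del: cf_den.simps)
    then have "fin_cfrac (\<lambda>n. real (a n)) n - \<tau> = - err (Suc (Suc n)) / ?q n"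
      unfolding fin_cfrac_conv[of a, OF a_pos] err_def by (simp add: field_simps del: cf_den.simps cf_num.simps)
    then have "norm (fin_cfrac (\<lambda>n. real (a n)) n - \<tau>) = \<bar>err (Suc (Suc n))\<bar> / ?q n"
      using q by (simp add: abs_divide del: cf_den.simps)
    then show ?thesis using abs_err_le[of "Suc n"] q by (simp add: divide_right_mono del: cf_den.simps)
  qed
  then have "(\<lambda>n. fin_cfrac (\<lambda>n. real (a n)) n - \<tau>) \<longlonglongrightarrow> 0"
    using inverse_cf_den_tendsto_0[of a, OF a_pos]
    by (rule Lim_null_comparison[OF always_eventually[OF allI]])
  then have "fin_cfrac (\<lambda>n. real (a n)) \<longlonglongrightarrow> \<tau>" by (simp add: LIM_zero_iff)
  then show ?thesis unfolding inf_cfrac_def by (rule limI)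
qed

end

text \<open>All finite tails are at least 1, hence so are their limits; this makes the reciprocal
  continuous there and yields the recursion, which in turn sharpens the bound to a strict
  one.\<close>

lemma cfrac_expansion_of_seq:
  assumes "\<And>n. 0 < a n"
  shows "cfrac_expansion a (\<lambda>n. inf_cfrac (\<lambda>i. real (a (n + i))))"
proof
  fix n
  let ?f = "\<lambda>n. fin_cfrac (\<lambda>i. real (a (n + i)))" and ?t = "\<lambda>n. inf_cfrac (\<lambda>i. real (a (n + i)))"
  show "0 < a n" by (rule assms)
  have lim: "?f n \<longlonglongrightarrow> ?t n" for n
    using convergent_fin_cfrac[of "\<lambda>i. a (n + i)"] assms
    unfolding inf_cfrac_def by (simp add: convergent_LIMSEQ_iff)
  have ge: "1 \<le> ?f n k" for n k
  proof (induction k arbitrary: n)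
    case 0 then show ?case using assms[of n] by (simp add: Suc_leI)
  next
    case (Suc k)
    have "0 \<le> 1 / ?f (Suc n) k" using Suc[of "Suc n"] by simp
    moreover have "1 \<le> real (a n)" using assms[of n] by linarith
    ultimately have "1 \<le> real (a n) + 1 / ?f (Suc n) k" by linarith
    then show ?case by simp
  qed
  have t1: "1 \<le> ?t n" for n using LIMSEQ_le_const[OF lim[of n]] ge by blast
  have "(\<lambda>k. ?f n (Suc k)) \<longlonglongrightarrow> real (a n) + 1 / ?t (Suc n)"
    using t1[of "Suc n"] by (auto intro!: tendsto_intros lim[of "Suc n", simplified])
  moreover have "(\<lambda>k. ?f n (Suc k)) \<longlonglongrightarrow> ?t n" using LIMSEQ_Suc[OF lim] .
  ultimately show rec: "?t n = real (a n) + 1 / ?t (Suc n)" using LIMSEQ_unique by blast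
  have "0 < 1 / ?t (Suc n)" using t1[of "Suc n"] by simp
  then show "1 < ?t n" unfolding rec using assms[of n] by linarith
qed

text \<open>The usual algorithm: irrationality passes to each complete quotient, so the fractional
  part to be inverted never vanishes.\<close>

lemma cfrac_expansion_of_irrational:
  assumes "1 < x" "x \<notin> \<rat>"
  obtains a t where "cfrac_expansion a t" "t 0 = x"
proof -
  define t where "t = rec_nat x (\<lambda>_ y. 1 / (y - of_int \<lfloor>y\<rfloor>))"
  define a where "a n = nat \<lfloor>t n\<rfloor>" for n
  have tS: "t (Suc n) = 1 / (t n - of_int \<lfloor>t n\<rfloor>)" for n by (simp add: t_def)
  have t: "1 < t n \<and> t n \<notin> \<rat>" for n
  proof (induction n)
    case 0 then show ?case using assms by (simp add: t_def)
  next
    case (Suc n)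
    have "t n \<noteq> of_int \<lfloor>t n\<rfloor>" using Suc by (metis Rats_of_int)
    then have f: "0 < t n - of_int \<lfloor>t n\<rfloor>" "t n - of_int \<lfloor>t n\<rfloor> < 1" by linarith+
    have "t (Suc n) \<notin> \<rat>"
    proof
      assume "t (Suc n) \<in> \<rat>"
      then have "of_int \<lfloor>t n\<rfloor> + 1 / t (Suc n) \<in> \<rat>" by auto
      then show False using Suc unfolding tS by simp
    qed
    then show ?case using f unfolding tS by simp
  qed
  have "cfrac_expansion a t"
  proof
    fix n
    show "1 < t n" using t by blast
    have fl: "1 \<le> \<lfloor>t n\<rfloor>" using t[of n] by linarith
    then show "0 < a n" by (simp add: a_def)
    show "t n = real (a n) + 1 / t (Suc n)" unfolding tS a_def using fl by simp
  qed
  moreover have "t 0 = x" by (simp add: t_def)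
  ultimately show ?thesis using that by blast
qed

section \<open>The sail of a standard angle\<close>

context cfrac_expansion
begin

text \<open>The vertices are the convergents below \<open>\<tau>\<close>, the edge directions the convergents above it.
  The \<open>i\<close>-th edge lies on the line \<open>cross z (dir i) = 1\<close>.\<close>

definition vert :: "nat \<Rightarrow> real^2" where
  "vert i = vector [of_int (cf_den a (2 * i)), of_int (cf_num a (2 * i))]"

definition dir :: "nat \<Rightarrow> real^2" where
  "dir i = vector [of_int (cf_den a (2 * i + 1)), of_int (cf_num a (2 * i + 1))]"

definition edge :: "nat \<Rightarrow> (real^2) set" where
  "edge i = closed_segment (vert i) (vert (Suc i))"

abbreviation horiz :: "real^2" where "horiz \<equiv> vector [1, 0]"
abbreviation slope_vec :: "real^2" where "slope_vec \<equiv> vector [1, \<tau>]"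

abbreviation std_cone :: "(real^2) set" where "std_cone \<equiv> angle_cone horiz 0 slope_vec"

definition lhull :: "(real^2) set" where
  "lhull = convex hull (std_cone \<inter> int_lattice - {0})"

lemma vert_0: "vert 0 = horiz" and dir_0: "dir 0 = vector [0, 1]"
  by (simp_all add: vert_def dir_def)

lemma vert_Suc: "vert (Suc i) = vert i + real (a (2 * i)) *\<^sub>R dir i"
  by (simp add: vert_def dir_def vec2_eq_iff)

lemma dir_Suc: "dir (Suc i) = dir i + real (a (2 * i + 1)) *\<^sub>R vert (Suc i)"
  by (simp add: vert_def dir_def vec2_eq_iff)

lemma cross_vert_dir: "cross (vert i) (dir i) = 1"
proof (induction i)
  case 0 then show ?case by (simp add: vert_0 dir_0 cross_def)
next
  case (Suc i)
  have "cross (vert (Suc i)) (dir (Suc i)) = cross (vert (Suc i)) (dir i)"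
    unfolding dir_Suc by (simp add: cross_linear)
  also have "\<dots> = cross (vert i) (dir i)" unfolding vert_Suc by (simp add: cross_linear)
  finally show ?case using Suc by simp
qed

lemma cross_vert_Suc_dir: "cross (vert (Suc i)) (dir i) = 1"
  unfolding vert_Suc by (simp add: cross_linear cross_vert_dir)

lemma cross_dir_dir: "cross (dir i) (dir (Suc i)) = - real (a (2 * i + 1))"
  unfolding dir_Suc using cross_vert_Suc_dir[of i] cross_skew[of "dir i" "vert (Suc i)"]
  by (simp add: cross_linear)

lemma vert_in_lattice: "vert i \<in> int_lattice" and dir_in_lattice: "dir i \<in> int_lattice"
  by (simp_all add: int_lattice_iff vert_def dir_def)

lemma primitive_dir: "primitive (dir i)"
  using cross_vert_dir[of i] cross_skew[of "dir i" "vert i"]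
  by (intro primitiveI[OF dir_in_lattice vert_in_lattice[of i]]) simp

lemma dir_coord: "0 \<le> dir i $ 1" "1 \<le> dir i $ 2"
  using cf_den_nonneg[of a "2 * i + 1"] cf_num_Suc_pos[of a "2 * i", OF a_pos] by (simp_all add: dir_def)

text \<open>Makes the second coordinate a parameter along the broken line that increases without
  bound.\<close>

lemma vert_height_Suc: "vert i $ 2 + 1 \<le> vert (Suc i) $ 2"
proof -
  have "1 * 1 \<le> real (a (2 * i)) * dir i $ 2"
    using a_pos[of "2 * i"] dir_coord(2)[of i] by (intro mult_mono) auto
  then show ?thesis unfolding vert_Suc by simp
qed

lemma vert_height_ge: "real i \<le> vert i $ 2"
proof (induction i)
  case (Suc i) then show ?case using vert_height_Suc[of i] by simp
qed (simp add: vert_0)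

lemma vert_height_mono: assumes "i \<le> j" shows "vert i $ 2 \<le> vert j $ 2"
proof -
  have "vert n $ 2 \<le> vert (Suc n) $ 2" for n using vert_height_Suc[of n] by linarith
  then show ?thesis using lift_Suc_mono_le[of "\<lambda>i. vert i $ 2"] assms by blast
qed

lemma height_locate:
  assumes "0 \<le> y" obtains j where "vert j $ 2 \<le> y" "y < vert (Suc j) $ 2"
proof -
  obtain n where "y < real n" using reals_Archimedean2 by blast
  then have ex: "y < vert n $ 2" using vert_height_ge[of n] by linarith
  define k where "k = (LEAST n. y < vert n $ 2)"
  have k: "y < vert k $ 2" unfolding k_def by (rule LeastI[of _ n]) fact
  then have "k \<noteq> 0" using assms vert_0 by (cases "k = 0") auto
  then obtain j where j: "k = Suc j" using not0_implies_Suc by blast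
  then have "\<not> y < vert j $ 2" using not_less_Least[of j "\<lambda>n. y < vert n $ 2"] unfolding k_def by simp
  then show ?thesis using that k j by force
qed

lemma cone_iff: "z \<in> std_cone \<longleftrightarrow> 0 \<le> z $ 2 \<and> z $ 2 \<le> \<tau> * z $ 1"
proof
  assume "z \<in> std_cone"
  then obtain s t' where "0 \<le> s" "0 \<le> t'" "z = 0 + s *\<^sub>R (horiz - 0) + t' *\<^sub>R (slope_vec - 0)"
    unfolding angle_cone_def by blast
  then show "0 \<le> z $ 2 \<and> z $ 2 \<le> \<tau> * z $ 1" using t_gt_1[of 0] by (simp add: algebra_simps)
next
  assume z: "0 \<le> z $ 2 \<and> z $ 2 \<le> \<tau> * z $ 1"
  show "z \<in> std_cone" unfolding angle_cone_def
  proof (intro CollectI exI conjI)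
    show "z = 0 + (z $ 1 - z $ 2 / \<tau>) *\<^sub>R (horiz - 0) + (z $ 2 / \<tau>) *\<^sub>R (slope_vec - 0)"
      using t_gt_1[of 0] by (simp add: vec2_eq_iff)
    show "0 \<le> z $ 1 - z $ 2 / \<tau>" "0 \<le> z $ 2 / \<tau>"
      using z t_gt_1[of 0] by (auto simp: divide_le_eq mult.commute)
  qed
qed

lemma vert_below: "vert i $ 2 < \<tau> * vert i $ 1"
  using err_even[of i] by (simp add: err_def vert_def)

lemma vert_shift_in_points: "vert i + real n *\<^sub>R horiz \<in> std_cone \<inter> int_lattice - {0}"
proof -
  have "0 \<le> \<tau> * real n" using t_gt_1[of 0] by simp
  moreover have h: "0 \<le> vert i $ 2" using vert_height_ge[of i] by linarith
  moreover have "0 < \<tau> * vert i $ 1" using h vert_below[of i] by linarith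
  then have "0 < vert i $ 1" using t_gt_1[of 0] by (simp add: zero_less_mult_iff)
  ultimately have "vert i + real n *\<^sub>R horiz \<in> std_cone" "vert i + real n *\<^sub>R horiz \<noteq> 0"
    using vert_below[of i] by (auto simp: cone_iff vec2_eq_iff algebra_simps)
  moreover have "vert i + real n *\<^sub>R horiz \<in> int_lattice"
    by (intro int_lattice_closed vert_in_lattice) (auto simp: int_lattice_iff)
  ultimately show ?thesis by blast
qed

lemma points_level:
  assumes "z \<in> std_cone \<inter> int_lattice - {0}" shows "1 \<le> cross z (dir i)"
proof -
  have z: "0 \<le> z $ 2" "z $ 2 \<le> \<tau> * z $ 1" "z \<noteq> 0" using assms by (auto simp: cone_iff)
  have "0 \<le> \<tau> * z $ 1" using z by linarith
  then have "0 \<le> z $ 1" using t_gt_1[of 0] by (simp add: zero_le_mult_iff)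
  moreover have "z $ 1 \<noteq> 0" using z by (auto simp: vec2_eq_iff)
  ultimately have z1: "0 < z $ 1" by simp
  have "z $ 2 * dir i $ 1 \<le> \<tau> * z $ 1 * dir i $ 1"
    using z dir_coord(1) by (intro mult_right_mono)
  \<comment> \<open>Replacing \<open>z $ 2\<close> by its upper bound \<open>\<tau> * z $ 1\<close>
    in the determinant leaves this product.\<close>
  then have "z $ 1 * (- err (2 * i + 1)) \<le> cross z (dir i)"
    by (simp add: cross_def err_def dir_def algebra_simps)
  moreover have "0 < z $ 1 * (- err (2 * i + 1))" using z1 err_odd[of i] by (intro mult_pos_pos) auto
  ultimately have pos: "0 < cross z (dir i)" by linarith
  have "cross z (dir i) \<in> \<int>" using assms dir_in_lattice by (intro cross_int_lattice) auto
  then obtain m where "cross z (dir i) = of_int m" by (auto elim: Ints_cases)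
  then show ?thesis using pos by simp
qed

lemma edge_height: "z \<in> edge i \<Longrightarrow> vert i $ 2 \<le> z $ 2 \<and> z $ 2 \<le> vert (Suc i) $ 2"
proof -
  assume "z \<in> edge i"
  then obtain u where u: "0 \<le> u" "u \<le> 1" "z = (1 - u) *\<^sub>R vert i + u *\<^sub>R vert (Suc i)"
    by (auto simp: edge_def closed_segment_def)
  have eq: "z $ 2 = vert i $ 2 + u * (vert (Suc i) $ 2 - vert i $ 2)"
    unfolding u(3) by (simp add: algebra_simps)
  moreover have d: "0 \<le> vert (Suc i) $ 2 - vert i $ 2" using vert_height_Suc[of i] by simp
  moreover have "u * (vert (Suc i) $ 2 - vert i $ 2) \<le> 1 * (vert (Suc i) $ 2 - vert i $ 2)"
    using u d by (intro mult_right_mono)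
  ultimately show ?thesis using mult_nonneg_nonneg[OF u(1) d] by simp
qed

lemma edge_level: "z \<in> edge i \<Longrightarrow> cross z (dir i) = 1"
  by (auto simp: edge_def closed_segment_def cross_linear cross_vert_dir cross_vert_Suc_dir)

text \<open>Coordinates in the strip of one edge: the point of the edge at the same height, and a
  signed horizontal offset \<open>s\<close>.\<close>

lemma strip:
  assumes "vert i $ 2 \<le> z $ 2" "z $ 2 \<le> vert (Suc i) $ 2"
  obtains u s where "0 \<le> u" "u \<le> 1" "(1 - u) *\<^sub>R vert i + u *\<^sub>R vert (Suc i) \<in> edge i"
    "z = (1 - u) *\<^sub>R vert i + u *\<^sub>R vert (Suc i) + s *\<^sub>R horiz"
proof -
  let ?d = "vert (Suc i) $ 2 - vert i $ 2"
  define u where "u = (z $ 2 - vert i $ 2) / ?d"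
  define c where "c = (1 - u) *\<^sub>R vert i + u *\<^sub>R vert (Suc i)"
  have d: "0 < ?d" using vert_height_Suc[of i] by simp
  have u: "0 \<le> u" "u \<le> 1" using assms d unfolding u_def by simp_all
  have "c $ 2 = vert i $ 2 + u * ?d" unfolding c_def by (simp add: algebra_simps)
  also have "u * ?d = z $ 2 - vert i $ 2" unfolding u_def using d by simp
  finally have "z = c + (z $ 1 - c $ 1) *\<^sub>R horiz" by (simp add: vec2_eq_iff)
  moreover have "c \<in> edge i" using u unfolding edge_def c_def closed_segment_def by blast
  ultimately show ?thesis using that u unfolding c_def by blast
qed

lemma level_shift: "cross (z + s *\<^sub>R horiz) (dir i) = cross z (dir i) + s * dir i $ 2"
  by (simp add: cross_def algebra_simps)

text \<open>A real shift lies between the lattice points obtained by the shifts 0 and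
  \<open>n\<close>.\<close>

lemma vert_shift_in_hull: assumes "0 \<le> s" shows "vert i + s *\<^sub>R horiz \<in> lhull"
proof -
  obtain n where n: "s < real n" using reals_Archimedean2 by blast
  then have n0: "0 < real n" using assms by linarith
  have "vert i + s *\<^sub>R horiz = (1 - s / real n) *\<^sub>R (vert i + real 0 *\<^sub>R horiz) + (s / real n) *\<^sub>R (vert i + real n *\<^sub>R horiz)"
    using n0 by (simp add: vec2_eq_iff algebra_simps)
  moreover have mem: "vert i + real k *\<^sub>R horiz \<in> lhull" for k
    unfolding lhull_def by (rule hull_inc[OF vert_shift_in_points])
  moreover have "convex lhull" unfolding lhull_def by (rule convex_convex_hull)
  moreover have "0 \<le> s / real n" "s / real n \<le> 1" using n n0 assms by simp_all
  ultimately show ?thesis using convexD_alt[OF _ mem mem] by metis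
qed

text \<open>The inequality of the edge says that the offset is nonnegative; then \<open>z\<close>
  lies on the edge moved to the right, whose end points are in the hull.\<close>

lemma strip_in_hull:
  assumes "vert i $ 2 \<le> z $ 2" "z $ 2 \<le> vert (Suc i) $ 2" "1 \<le> cross z (dir i)"
  shows "z \<in> lhull"
proof -
  obtain u s where us: "0 \<le> u" "u \<le> 1" "(1 - u) *\<^sub>R vert i + u *\<^sub>R vert (Suc i) \<in> edge i"
    "z = (1 - u) *\<^sub>R vert i + u *\<^sub>R vert (Suc i) + s *\<^sub>R horiz"
    using strip[OF assms(1,2)] by metis
  have "0 \<le> s * dir i $ 2" using assms(3) unfolding us(4) level_shift edge_level[OF us(3)] by simp
  then have s: "0 \<le> s" using dir_coord(2)[of i] by (simp add: zero_le_mult_iff)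
  have "z = (1 - u) *\<^sub>R (vert i + s *\<^sub>R horiz) + u *\<^sub>R (vert (Suc i) + s *\<^sub>R horiz)"
    unfolding us(4) by (simp add: algebra_simps)
  moreover have "convex lhull" unfolding lhull_def by (rule convex_convex_hull)
  ultimately show ?thesis
    using vert_shift_in_hull[OF s] us(1,2) by (simp add: convexD_alt)
qed

section \<open>The hull of the lattice points as an intersection of half-planes\<close>

lemma cross_inner: "cross z d = vector [d $ 2, - d $ 1] \<bullet> z"
  by (simp add: cross_def inner_vec_def sum_2)

lemma height_inner: "z $ 2 = (vector [0, 1] :: real^2) \<bullet> z"
  by (simp add: inner_vec_def sum_2)

definition region :: "(real^2) set" where
  "region = {z. 0 \<le> z $ 2} \<inter> (\<Inter>i. {z. 1 \<le> cross z (dir i)})"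

lemma region_iff: "z \<in> region \<longleftrightarrow> 0 \<le> z $ 2 \<and> (\<forall>i. 1 \<le> cross z (dir i))"
  by (auto simp: region_def)

lemma closed_region: "closed region"
  unfolding region_def height_inner cross_inner
  by (intro closed_Int closed_INT ballI closed_halfspace_ge)

lemma convex_region: "convex region"
  unfolding region_def height_inner cross_inner
  by (intro convex_Int convex_INT convex_halfspace_ge)

text \<open>The half-planes contain all the lattice points in question. Conversely, every height
  falls into some strip, and there the inequality of that one edge gives membership in the
  hull.\<close>

lemma lhull_eq_region: "lhull = region"
proof
  have "std_cone \<inter> int_lattice - {0} \<subseteq> region"
  proof
    fix z assume z: "z \<in> std_cone \<inter> int_lattice - {0}"
    then have "0 \<le> z $ 2" using cone_iff by blast
    then show "z \<in> region" using points_level[OF z] by (simp add: region_iff)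
  qed
  then show "lhull \<subseteq> region" unfolding lhull_def using convex_region by (rule hull_minimal)
  show "region \<subseteq> lhull"
  proof
    fix z assume z: "z \<in> region"
    then obtain j where "vert j $ 2 \<le> z $ 2" "z $ 2 < vert (Suc j) $ 2"
      using height_locate region_iff by metis
    then show "z \<in> lhull" using z strip_in_hull[of j z] by (simp add: region_iff)
  qed
qed

lemma edge_subset_region: "edge i \<subseteq> region"
proof -
  have "vert k \<in> region" for k using vert_shift_in_hull[of 0 k] by (simp add: lhull_eq_region)
  then show ?thesis unfolding edge_def using convex_region by (simp add: closed_segment_subset)
qed

text \<open>Relates an arbitrary index \<open>i\<close> to the edge \<open>j\<close> at the height
  of \<open>z\<close>. Inequality \<open>j\<close> makes the horizontal offset from edge
  \<open>j\<close> nonnegative; the edge point already satisfies inequality \<open>i\<close>, whose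
  form grows to the right, so the offset is also at most 0.\<close>

lemma region_level_edge:
  assumes "z \<in> region" "cross z (dir i) = 1" "vert j $ 2 \<le> z $ 2" "z $ 2 \<le> vert (Suc j) $ 2"
  shows "z \<in> edge j"
proof -
  obtain u s where us: "(1 - u) *\<^sub>R vert j + u *\<^sub>R vert (Suc j) \<in> edge j"
    "z = (1 - u) *\<^sub>R vert j + u *\<^sub>R vert (Suc j) + s *\<^sub>R horiz"
    using strip[OF assms(3,4)] by metis
  define c where "c = (1 - u) *\<^sub>R vert j + u *\<^sub>R vert (Suc j)"
  have c: "c \<in> edge j" "z = c + s *\<^sub>R horiz" using us c_def by auto
  have "1 \<le> cross z (dir j)" using assms(1) by (simp add: region_iff)
  then have "0 \<le> s * dir j $ 2" unfolding c(2) level_shift edge_level[OF c(1)] by simp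
  then have "0 \<le> s" using dir_coord(2)[of j] by (simp add: zero_le_mult_iff)
  moreover have "1 \<le> cross c (dir i)" using c(1) edge_subset_region[of j] by (auto simp: region_iff)
  then have "s * dir i $ 2 \<le> 0" using assms(2) unfolding c(2) level_shift by simp
  then have "s \<le> 0" using dir_coord(2)[of i] by (simp add: mult_le_0_iff)
  ultimately show ?thesis using c by simp
qed

text \<open>Past its end point the line of edge \<open>i\<close> violates the inequality of edge \<open>i + 1\<close>.\<close>

lemma region_level_height:
  assumes "z \<in> region" "cross z (dir i) = 1" shows "z $ 2 \<le> vert (Suc i) $ 2"
proof -
  have "cross (dir i) (z - vert (Suc i)) = 0"
    using assms(2) cross_vert_Suc_dir[of i] cross_skew[of "dir i"] by (simp add: cross_linear)
  then obtain c where "z - vert (Suc i) = c *\<^sub>R dir i"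
    using cross_eq_0D primitive_nonzero[OF primitive_dir] by blast
  then have z: "z = vert (Suc i) + c *\<^sub>R dir i" by (simp add: algebra_simps)
  have "1 \<le> cross z (dir (Suc i))" using assms(1) by (simp add: region_iff)
  then have "c * real (a (2 * i + 1)) \<le> 0"
    unfolding z by (simp add: cross_linear cross_vert_dir cross_dir_dir)
  then have "c \<le> 0" using a_pos[of "2 * i + 1"] by (auto simp: mult_le_0_iff)
  then have "c * dir i $ 2 \<le> 0" using dir_coord(2)[of i] by (simp add: mult_le_0_iff)
  then show ?thesis unfolding z by simp
qed

text \<open>Below a given height only finitely many of the inequalities defining \<open>region\<close> matter, so
  \<open>above N\<close> is open although \<open>region\<close> is an infinite intersection.\<close>

definition above :: "nat \<Rightarrow> (real^2) set" where
  "above N = {w. w $ 2 < vert N $ 2} \<inter> (\<Inter>i\<in>{..<N}. {w. 1 < cross w (dir i)})"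

lemma open_above: "open (above N)"
  unfolding above_def height_inner cross_inner
  by (intro open_Int open_INT ballI finite_lessThan open_halfspace_lt open_halfspace_gt)

lemma above_iff: "w \<in> above N \<longleftrightarrow> w $ 2 < vert N $ 2 \<and> (\<forall>i<N. 1 < cross w (dir i))"
  by (auto simp: above_def)

lemma above_disjoint_edge: assumes "w \<in> above N" shows "w \<notin> edge j"
proof
  assume w: "w \<in> edge j"
  have "vert j $ 2 < vert N $ 2" using edge_height[OF w] assms by (auto simp: above_iff)
  then have "j < N" using vert_height_mono[of N j] by (meson not_less)
  then show False using edge_level[OF w] assms by (auto simp: above_iff)
qed

lemma above_in_hull: assumes "w \<in> above N" "0 \<le> w $ 2" shows "w \<in> lhull"
proof -
  obtain j where j: "vert j $ 2 \<le> w $ 2" "w $ 2 < vert (Suc j) $ 2"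
    using height_locate[OF assms(2)] by metis
  then have "vert j $ 2 < vert N $ 2" using assms by (auto simp: above_iff)
  then have "j < N" using vert_height_mono[of N j] by (meson not_less)
  then show ?thesis using strip_in_hull[of j w] j assms by (auto simp: above_iff less_imp_le)
qed

text \<open>The dichotomy behind both closedness of the broken line and the frontier of the hull:
  off the edges a point has an open neighbourhood that avoids every edge.\<close>

lemma region_cases:
  assumes "z \<in> region" obtains i where "z \<in> edge i" | N where "z \<in> above N"
proof (cases "\<exists>i. cross z (dir i) = 1")
  case True
  then obtain i where i: "cross z (dir i) = 1" by blast
  obtain j where "vert j $ 2 \<le> z $ 2" "z $ 2 < vert (Suc j) $ 2"
    using height_locate assms region_iff by metis
  then have "z \<in> edge j" using region_level_edge[OF assms i, of j] by simp
  then show ?thesis using that by blast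
next
  case False
  then have "1 < cross z (dir i)" for i using assms by (metis region_iff less_le)
  moreover obtain j where "z $ 2 < vert (Suc j) $ 2" using height_locate assms region_iff by metis
  ultimately have "z \<in> above (Suc j)" by (simp add: above_iff)
  then show ?thesis using that by blast
qed

lemma closed_edges: "closed (\<Union>i. edge i)"
proof -
  have "z \<in> (\<Union>i. edge i)" if z: "z \<in> closure (\<Union>i. edge i)" for z
  proof -
    have "(\<Union>i. edge i) \<subseteq> region" using edge_subset_region by blast
    then have "z \<in> region" using z closure_minimal[OF _ closed_region] by blast
    then show ?thesis
    proof (cases rule: region_cases)
      case (2 N)
      have "above N \<inter> (\<Union>i. edge i) = {}" using above_disjoint_edge by blast
      then have "above N \<inter> closure (\<Union>i. edge i) = {}"
        using open_Int_closure_eq_empty[OF open_above] by blast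
      then show ?thesis using 2 z by blast
    qed blast
  qed
  then have "closure (\<Union>i. edge i) \<subseteq> (\<Union>i. edge i)" by (rule subsetI)
  then show ?thesis by (simp only: closure_subset_eq)
qed

section \<open>The sail as the union of the edges\<close>

lemma interior_cone_height: assumes "z \<in> interior std_cone" shows "0 < z $ 2"
proof -
  have "std_cone \<subseteq> {z. vector [0, 1] \<bullet> z \<ge> 0}" using cone_iff height_inner by auto
  then have "z \<in> interior {z. (vector [0, 1] :: real^2) \<bullet> z \<ge> 0}" using assms interior_mono by blast
  then show ?thesis
    by (subst (asm) interior_halfspace_ge) (simp_all add: vec2_eq_iff height_inner[symmetric])
qed

text \<open>The segment has to be open because \<open>vert 0\<close> lies on the boundary ray; the
  closure in the definition of the sail restores it.\<close>

lemma open_edge_in_interior_cone: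
  assumes "z \<in> open_segment (vert i) (vert (Suc i))" shows "z \<in> interior std_cone"
proof -
  obtain u where u: "0 < u" "u < 1" "z = (1 - u) *\<^sub>R vert i + u *\<^sub>R vert (Suc i)"
    using assms by (auto simp: in_segment)
  let ?S = "{z. 0 < (vector [0, 1] :: real^2) \<bullet> z} \<inter> {z. 0 < (vector [\<tau>, - 1] :: real^2) \<bullet> z}"
  have S: "z \<in> ?S \<longleftrightarrow> 0 < z $ 2 \<and> z $ 2 < \<tau> * z $ 1" for z :: "real^2"
    by (simp add: inner_vec_def sum_2)
  have "0 < vert (Suc i) $ 2" using vert_height_ge[of "Suc i"] by simp
  moreover have "0 \<le> vert i $ 2" using vert_height_ge[of i] by linarith
  ultimately have "0 < z $ 2" using u by (simp add: add_nonneg_pos)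
  moreover have "0 < (1 - u) * (\<tau> * vert i $ 1 - vert i $ 2) + u * (\<tau> * vert (Suc i) $ 1 - vert (Suc i) $ 2)"
    using u vert_below[of i] vert_below[of "Suc i"] by (intro add_pos_pos mult_pos_pos) auto
  then have "z $ 2 < \<tau> * z $ 1" unfolding u(3) by (simp add: algebra_simps)
  ultimately have "z \<in> ?S" using S by blast
  moreover have "?S \<subseteq> std_cone"
  proof
    fix w assume "w \<in> ?S"
    then show "w \<in> std_cone" unfolding S cone_iff by simp
  qed
  moreover have "open ?S" by (intro open_Int open_halfspace_gt)
  ultimately show ?thesis using interior_maximal by blast
qed

text \<open>The line of the edge supports the hull.\<close>

lemma edge_in_frontier_hull: assumes "z \<in> edge i" shows "z \<in> frontier lhull"
proof -
  have "z \<notin> interior lhull"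
  proof
    assume z: "z \<in> interior lhull"
    have "lhull \<subseteq> {z. vector [dir i $ 2, - dir i $ 1] \<bullet> z \<ge> 1}"
      unfolding lhull_eq_region by (auto simp: region_iff cross_inner[symmetric])
    then have "z \<in> interior {z. vector [dir i $ 2, - dir i $ 1] \<bullet> z \<ge> 1}"
      using z interior_mono by blast
    moreover have "vector [dir i $ 2, - dir i $ 1] \<noteq> (0 :: real^2)"
      using dir_coord(2)[of i] by (auto simp: vec2_eq_iff)
    ultimately have "1 < cross z (dir i)" by (simp add: interior_halfspace_ge cross_inner)
    then show False using edge_level[OF assms] by simp
  qed
  moreover have "z \<in> lhull" using assms edge_subset_region lhull_eq_region by blast
  ultimately show ?thesis using closure_subset by (auto simp: frontier_def)
qed

text \<open>Off the edges a point of the hull has some \<open>above N\<close> around it; cut down to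
  positive heights, this is an open subset of the hull, so the point is not on the frontier.
  Conversely the open edges lie in the set whose closure is taken.\<close>

lemma sail_eq: "sail horiz 0 slope_vec = (\<Union>i. edge i)"
proof -
  let ?F = "frontier lhull \<inter> interior std_cone"
  have sail: "sail horiz 0 slope_vec = closure ?F" unfolding sail_def lhull_def ..
  have "?F \<subseteq> (\<Union>i. edge i)"
  proof
    fix z assume z: "z \<in> ?F"
    then have "z \<in> region" "z \<notin> interior lhull"
      using closed_region by (auto simp: frontier_def lhull_eq_region)
    then show "z \<in> (\<Union>i. edge i)"
    proof (cases rule: region_cases)
      case (2 N)
      have "above N \<inter> {w. (vector [0, 1] :: real^2) \<bullet> w > 0} \<subseteq> lhull"
        using above_in_hull by (auto simp: height_inner[symmetric])
      moreover have "open (above N \<inter> {w. (vector [0, 1] :: real^2) \<bullet> w > 0})"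
        by (intro open_Int open_above open_halfspace_gt)
      ultimately have "above N \<inter> {w. (vector [0, 1] :: real^2) \<bullet> w > 0} \<subseteq> interior lhull"
        by (rule interior_maximal)
      moreover have "0 < z $ 2" using z interior_cone_height by blast
      ultimately show ?thesis using 2 \<open>z \<notin> interior lhull\<close> by (auto simp: height_inner[symmetric])
    qed blast
  qed
  then have "closure ?F \<subseteq> (\<Union>i. edge i)" using closed_edges by (simp add: closure_minimal)
  moreover have "edge i \<subseteq> closure ?F" for i
  proof -
    have "vert i \<noteq> vert (Suc i)" using vert_height_Suc[of i] by auto
    then have "edge i = closure (open_segment (vert i) (vert (Suc i)))" by (simp add: edge_def)
    moreover have "open_segment (vert i) (vert (Suc i)) \<subseteq> ?F"
      using edge_in_frontier_hull[of _ i] open_edge_in_interior_cone segment_open_subset_closed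
      unfolding edge_def by blast
    ultimately show ?thesis using closure_mono by metis
  qed
  ultimately show ?thesis using sail by blast
qed

section \<open>Uniqueness of the vertex sequence\<close>

lemma edge_of_height:
  assumes "z \<in> (\<Union>k. edge k)" "vert i $ 2 \<le> z $ 2" "z $ 2 \<le> vert (Suc i) $ 2"
  shows "z \<in> edge i"
proof -
  obtain k where k: "z \<in> edge k" using assms(1) by blast
  then show ?thesis
    using region_level_edge[OF _ edge_level[OF k] assms(2,3)] edge_subset_region by blast
qed

text \<open>A straight segment inside the sail cannot pass a vertex: it would leave edge
  \<open>i\<close> along the line of that edge, where the hull ends at
  \<open>vert (Suc i)\<close>.\<close>

lemma segment_in_edge:
  assumes "closed_segment P Q \<subseteq> (\<Union>k. edge k)"
  shows "\<exists>i. P \<in> edge i \<and> Q \<in> edge i"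
proof -
  have main: "\<exists>i. P \<in> edge i \<and> Q \<in> edge i"
    if seg: "closed_segment P Q \<subseteq> (\<Union>k. edge k)" and le: "P $ 2 \<le> Q $ 2" for P Q
  proof -
    have PQ: "P \<in> (\<Union>k. edge k)" "Q \<in> (\<Union>k. edge k)" using seg by auto
    have reg: "Q \<in> region" "P \<in> region" using PQ edge_subset_region by blast+
    obtain i where i: "vert i $ 2 \<le> P $ 2" "P $ 2 < vert (Suc i) $ 2"
      using height_locate reg(2) region_iff by metis
    have P: "P \<in> edge i" using edge_of_height[OF PQ(1), of i] i by simp
    show ?thesis
    proof (cases "Q $ 2 \<le> vert (Suc i) $ 2")
      case True
      then show ?thesis using edge_of_height[OF PQ(2), of i] i le P by auto
    next
      case False
      define u where "u = (vert (Suc i) $ 2 - P $ 2) / (Q $ 2 - P $ 2)"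
      have u: "0 < u" "u \<le> 1" "u * (Q $ 2 - P $ 2) = vert (Suc i) $ 2 - P $ 2"
        using False i by (auto simp: u_def)
      define R where "R = (1 - u) *\<^sub>R P + u *\<^sub>R Q"
      have "R \<in> closed_segment P Q" unfolding R_def closed_segment_def using u by force
      moreover have "R $ 2 = vert (Suc i) $ 2" using u(3) unfolding R_def by (simp add: algebra_simps)
      ultimately have "R \<in> edge i" using edge_of_height[of R i] seg vert_height_mono[of i "Suc i"] by auto
      then have "cross R (dir i) = 1" by (rule edge_level)
      \<comment> \<open>The form is affine along the segment and equals 1 at \<open>P\<close> and at
        the different point \<open>R\<close>, hence also at \<open>Q\<close>.\<close>
      then have "u * cross Q (dir i) = u * 1" using edge_level[OF P]
        unfolding R_def by (simp add: cross_linear algebra_simps)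
      then have "cross Q (dir i) = 1" using u by simp
      then show ?thesis using region_level_height[OF reg(1)] False by blast
    qed
  qed
  show ?thesis
  proof (cases "P $ 2 \<le> Q $ 2")
    case True then show ?thesis using main assms by blast
  next
    case False then show ?thesis using main[of Q P] assms by (auto simp: closed_segment_commute)
  qed
qed

lemma edge_inter:
  assumes "z \<in> edge i" "z \<in> edge j" "i < j" shows "j = Suc i" "z = vert j"
proof -
  have z: "z $ 2 \<le> vert (Suc i) $ 2" "vert j $ 2 \<le> z $ 2" using assms edge_height by blast+
  show j: "j = Suc i"
  proof (rule ccontr)
    assume "j \<noteq> Suc i"
    then have "Suc (Suc i) \<le> j" using assms(3) by simp
    then show False using vert_height_mono[of "Suc (Suc i)" j] vert_height_Suc[of "Suc i"] z by simp
  qed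
  obtain u where u: "0 \<le> u" "u \<le> 1" "z = (1 - u) *\<^sub>R vert j + u *\<^sub>R vert (Suc j)"
    using assms(2) by (auto simp: edge_def closed_segment_def)
  have "z $ 2 = vert j $ 2 + u * (vert (Suc j) $ 2 - vert j $ 2)"
    unfolding u(3) by (simp add: algebra_simps)
  then have "u * (vert (Suc j) $ 2 - vert j $ 2) = 0" using z j by simp
  then have "u = 0" using vert_height_Suc[of j] by auto
  then show "z = vert j" using u by simp
qed

lemma vert_noncollinear: "\<not> collinear {vert i, vert (i + 1), vert (i + 2)}"
proof -
  have "vert (i + 1) - vert i = real (a (2 * i)) *\<^sub>R dir i"
    "vert (i + 2) - vert i = real (a (2 * i)) *\<^sub>R dir i + real (a (2 * i + 2)) *\<^sub>R dir (Suc i)"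
    using vert_Suc[of i] vert_Suc[of "Suc i"] by simp_all
  then show ?thesis
    using a_pos[of "2 * i"] a_pos[of "2 * i + 1"] a_pos[of "2 * i + 2"]
    by (simp add: collinear_iff_cross cross_linear cross_dir_dir)
qed

lemma is_sail_vertices_vert: "is_sail_vertices horiz 0 slope_vec vert"
  unfolding is_sail_vertices_def
proof (intro conjI allI)
  show "vert 0 \<in> ray 0 horiz" using rayI[of 1 0 horiz] by (simp add: vert_0)
  show "sail horiz 0 slope_vec = (\<Union>i. closed_segment (vert i) (vert (i + 1)))"
    unfolding sail_eq edge_def by simp
qed (rule vert_noncollinear)

text \<open>Each segment of \<open>W\<close> lies in a single edge. After a segment in edge
  \<open>i\<close>, the next one cannot stay there, since three points would be collinear, nor lie
  in an earlier edge, since that forces \<open>W (Suc i) = W i\<close>; so it lies in edge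
  \<open>i + 1\<close>, which meets edge \<open>i\<close> only in their common vertex.\<close>

lemma sail_vertices_unique:
  assumes W: "is_sail_vertices horiz 0 slope_vec W" shows "W = vert"
proof -
  have W0: "W 0 \<in> ray 0 horiz"
    and un: "(\<Union>k. edge k) = (\<Union>i. closed_segment (W i) (W (i + 1)))"
    and nc: "\<And>i. \<not> collinear {W i, W (i + 1), W (i + 2)}"
    using W unfolding is_sail_vertices_def sail_eq by blast+
  have step: "\<exists>j. W i \<in> edge j \<and> W (Suc i) \<in> edge j" for i
    using segment_in_edge[of "W i" "W (Suc i)"] un by auto
  have neq: "W i \<noteq> W (Suc i)" for i using nc[of i] by (auto simp: collinear_iff_cross)
  \<comment> \<open>The end of a segment is recognised as a vertex only from the next segment, so
    the induction claims no more than its membership in the edge.\<close>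
  have main: "W i = vert i \<and> W (Suc i) \<in> edge i" for i
  proof (induction i)
    case 0
    obtain j where j: "W 0 \<in> edge j" "W 1 \<in> edge j" using step[of 0] by auto
    have h: "W 0 $ 2 = 0" using W0 by (auto elim!: rayE)
    have "vert j $ 2 \<le> 0" using edge_height[OF j(1)] h by simp
    then have "j = 0" using vert_height_ge[of j] by linarith
    then have "cross (W 0) (dir 0) = 1" using edge_level[OF j(1)] by simp
    then have "W 0 = vert 0" using h by (simp add: vert_0 dir_0 cross_def vec2_eq_iff)
    then show ?case using j \<open>j = 0\<close> by simp
  next
    case (Suc i)
    obtain j where j: "W (Suc i) \<in> edge j" "W (Suc (Suc i)) \<in> edge j" using step[of "Suc i"] by auto
    have "j \<noteq> i"
    proof
      assume "j = i"
      then have eqs: "cross (W i) (dir i) = 1" "cross (W (Suc i)) (dir i) = 1" "cross (W (Suc (Suc i))) (dir i) = 1"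
        using j Suc edge_level step cross_vert_dir by auto
      have par: "\<exists>c. z - W i = c *\<^sub>R dir i" if "cross z (dir i) = 1" for z
        using that eqs(1) cross_skew[of "dir i"] primitive_nonzero[OF primitive_dir[of i]]
        by (intro cross_eq_0D) (simp_all add: cross_linear)
      obtain c d where "W (Suc i) - W i = c *\<^sub>R dir i" "W (Suc (Suc i)) - W i = d *\<^sub>R dir i"
        using par eqs by blast
      then show False using nc[of i] by (simp add: collinear_iff_cross cross_linear)
    qed
    moreover have "\<not> j < i"
    proof
      assume "j < i"
      then have "W (Suc i) = vert i" using edge_inter(2)[OF j(1)] Suc by blast
      then show False using Suc neq[of i] by simp
    qed
    ultimately have "i < j" by simp
    then have "j = Suc i" "W (Suc i) = vert j" using edge_inter[OF _ j(1)] Suc by blast+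
    then show ?case using j by simp
  qed
  then show ?thesis by auto
qed

text \<open>Lengths and sines are computed directly in the image angle: the linear part of
  \<open>f\<close> keeps the edge directions primitive and changes determinants by a sign
  only.\<close>

lemma ltan_eq:
  assumes f: "lattice_affine f" "f 0 = V" "f ` ray 0 horiz = ray V A" "f ` ray 0 slope_vec = ray V B"
  shows "ltan A V B = \<tau>"
proof -
  have W: "sail_vertex A V B = f \<circ> vert"
    using sail_vertex_lattice_affine[OF f is_sail_vertices_vert sail_vertices_unique] .
  obtain L where L: "lattice_linear L" "\<And>x y. f x - f y = L (x - y)"
    using lattice_affine_diff[OF f(1)] by metis
  obtain \<delta> where \<delta>: "\<bar>\<delta>\<bar> = 1" "\<And>u v. cross (L u) (L v) = \<delta> * cross u v"
    using lattice_linear_cross[OF L(1)] by metis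
  have Ldir: "primitive (L (dir i))" for i
  proof (rule primitiveI)
    show "L (dir i) \<in> int_lattice" "L (vert i) \<in> int_lattice"
      by (auto intro: lattice_linear_in_lattice[OF L(1)] dir_in_lattice vert_in_lattice)
    show "\<bar>cross (L (dir i)) (L (vert i))\<bar> = 1"
      using \<delta> cross_vert_dir[of i] cross_skew[of "dir i" "vert i"] by (simp add: abs_mult)
  qed
  have f_Suc: "f (vert (Suc i)) = f (vert i) + real (a (2 * i)) *\<^sub>R L (dir i)" for i
  proof -
    have "f (vert (Suc i)) - f (vert i) = L (real (a (2 * i)) *\<^sub>R dir i)"
      unfolding L(2) by (simp add: vert_Suc)
    then show ?thesis
      using linear_scale[OF lattice_linear_linear[OF L(1)]] by (simp add: algebra_simps)
  qed
  have fL: "f (vert i) \<in> int_lattice" for i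
    using lattice_affine_in_lattice[OF f(1) vert_in_lattice] .
  have "ltan_seq A V B n = real (a n)" for n
  proof (cases "even n")
    case True
    then obtain i where n: "n = 2 * i" by (rule evenE)
    have "lattice_length (f (vert i)) (f (vert (Suc i))) = a (2 * i)"
      unfolding f_Suc by (rule lattice_length_primitive[OF Ldir fL])
    then show ?thesis by (simp add: ltan_seq_def W n)
  next
    case False
    then obtain i where n: "n = 2 * i + 1" by (rule oddE)
    let ?Y = "f (vert (Suc i))"
    \<comment> \<open>Seen from the middle vertex the first ray runs back along the previous edge,
      whence the minus sign.\<close>
    have X: "f (vert i) = ?Y + real (a (2 * i)) *\<^sub>R (- L (dir i))" unfolding f_Suc by simp
    have Z: "f (vert (Suc (Suc i))) = ?Y + real (a (2 * Suc i)) *\<^sub>R L (dir (Suc i))" by (rule f_Suc)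
    have c: "cross (- L (dir i)) (L (dir (Suc i))) = \<delta> * real (a (2 * i + 1))"
      by (simp add: cross_linear \<delta> cross_dir_dir)
    have "lsin (f (vert i)) ?Y (f (vert (Suc (Suc i)))) = \<bar>cross (- L (dir i)) (L (dir (Suc i)))\<bar>"
      unfolding X Z
    proof (rule lsin_eq_cross[OF primitive_uminus[OF Ldir] _ Ldir _ fL])
      show "cross (- L (dir i)) (L (dir (Suc i))) \<noteq> 0"
        unfolding c using \<delta>(1) a_pos[of "2 * i + 1"] by auto
    qed (use a_pos in auto)
    also have "\<dots> = real (a (2 * i + 1))" unfolding c using \<delta>(1) by (simp add: abs_mult)
    finally show ?thesis by (simp add: ltan_seq_def W n)
  qed
  then have "ltan_seq A V B = (\<lambda>n. real (a n))" by (rule ext)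
  then show ?thesis by (simp add: ltan_def inf_cfrac_eq)
qed

end

section \<open>Normal forms of angles and the two claims\<close>

lemma ray_scale: assumes "0 < c" shows "ray V (V + c *\<^sub>R d) = ray V (V + d)"
proof (intro equalityI subsetI)
  fix z assume "z \<in> ray V (V + c *\<^sub>R d)"
  then obtain s where "0 \<le> s" "z = V + s *\<^sub>R (V + c *\<^sub>R d - V)" by (rule rayE)
  then show "z \<in> ray V (V + d)" using rayI[of "s * c" V "V + d"] assms by simp
next
  fix z assume "z \<in> ray V (V + d)"
  then obtain s where "0 \<le> s" "z = V + s *\<^sub>R (V + d - V)" by (rule rayE)
  then show "z \<in> ray V (V + c *\<^sub>R d)" using rayI[of "s / c" V "V + c *\<^sub>R d"] assms by simp
qed

lemma primitive_direction:
  assumes "z \<in> int_lattice" "z \<noteq> 0"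
  obtains e c where "primitive e" "0 < c" "z = c *\<^sub>R e"
proof -
  obtain m n where mn: "z $ 1 = of_int m" "z $ 2 = of_int n"
    using assms(1) by (auto simp: int_lattice_iff elim!: Ints_cases)
  then have nz: "m \<noteq> 0 \<or> n \<noteq> 0" using assms(2) by (auto simp: vec2_eq_iff)
  define g where "g = gcd m n"
  have g: "g > 0" using nz unfolding g_def by (simp add: gcd_pos_int)
  obtain m' n' where m': "m = m' * g" "n = n' * g" "coprime m' n'"
    using gcd_coprime_exists[of m n] nz unfolding g_def by auto
  obtain x y where xy: "x * m' + y * n' = 1"
    using bezout_int[of m' n'] m'(3) by (auto simp: coprime_iff_gcd_eq_1)
  define e where "e = (vector [of_int m', of_int n'] :: real^2)"
  \<comment> \<open>The Bezout coefficients provide the partner vector of determinant 1.\<close>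
  have "cross e (vector [- of_int y, of_int x]) = of_int (x * m' + y * n')"
    by (simp add: cross_def e_def algebra_simps)
  then have "primitive e" using xy
    by (intro primitiveI[of e "vector [- of_int y, of_int x]"]) (auto simp: e_def int_lattice_iff)
  moreover have "z = of_int g *\<^sub>R e" using m' mn by (simp add: vec2_eq_iff e_def mult.commute)
  ultimately show ?thesis using that[of e "of_int g"] g by simp
qed

text \<open>In a basis \<open>e\<close>, \<open>w\<close> with \<open>e\<close> on the first ray the
  second ray gets positive coordinates \<open>\<gamma> < \<beta>\<close>, and
  \<open>x = \<beta> / \<gamma>\<close>. A vanishing \<open>\<gamma>\<close> or a rational
  \<open>x\<close> would put a lattice point on the second ray.\<close>

lemma angle_normal_form:
  assumes "R_irrational_angle A V B"
  obtains f x where "1 < x" "x \<notin> \<rat>" "lattice_affine f" "f 0 = V"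
    "f ` ray 0 (vector [1, 0]) = ray V A" "f ` ray 0 (vector [1, x]) = ray V B"
proof -
  have V: "V \<in> int_lattice" and nc: "cross (A - V) (B - V) \<noteq> 0"
    and rat: "open_ray V A \<inter> int_lattice \<noteq> {}" and irr: "open_ray V B \<inter> int_lattice = {}"
    using assms by (auto simp: R_irrational_angle_def collinear_iff_cross)
  obtain s where s: "0 < s" "V + s *\<^sub>R (A - V) \<in> int_lattice"
    using rat by (auto simp: open_ray_def)
  have "s *\<^sub>R (A - V) \<in> int_lattice" using int_lattice_closed(3)[OF s(2) V] by simp
  moreover have "s *\<^sub>R (A - V) \<noteq> 0" using s nc by auto
  ultimately obtain e c where e: "primitive e" "0 < c" "s *\<^sub>R (A - V) = c *\<^sub>R e"
    using primitive_direction by metis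
  have "A - V = (1 / s) *\<^sub>R (s *\<^sub>R (A - V))" using s by simp
  then have AV: "A = V + (c / s) *\<^sub>R e" unfolding e(3) by (simp add: algebra_simps)
  have eL: "e \<in> int_lattice" using e by (simp add: primitive_def)
  have no_latt: "w \<notin> int_lattice" if "0 < r" "w = r *\<^sub>R (B - V)" for r w
  proof
    assume "w \<in> int_lattice"
    then have "V + r *\<^sub>R (B - V) \<in> open_ray V B \<inter> int_lattice"
      using that V int_lattice_closed(2) unfolding open_ray_def by blast
    then show False using irr by blast
  qed
  have eB: "cross e (B - V) \<noteq> 0" using nc unfolding AV by (auto simp: cross_linear)
  obtain w0 where w0: "w0 \<in> int_lattice" "cross e w0 = 1" using e by (auto simp: primitive_def)
  define \<epsilon> where "\<epsilon> = sgn (cross e (B - V))"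
  have \<epsilon>: "\<epsilon> * \<epsilon> = 1" "\<bar>\<epsilon>\<bar> = 1" "\<epsilon> \<in> \<int>" "\<epsilon> * cross e (B - V) = \<bar>cross e (B - V)\<bar>"
    using eB by (auto simp: \<epsilon>_def sgn_if)
  define \<beta> where "\<beta> = \<bar>cross e (B - V)\<bar>"
  have \<beta>: "0 < \<beta>" using eB by (simp add: \<beta>_def)
  define \<alpha> where "\<alpha> = cross (B - V) w0"
  \<comment> \<open>Adding \<open>k\<close> copies of \<open>e\<close> to the second basis vector
    reduces the coordinate \<open>\<alpha>\<close> modulo \<open>\<beta>\<close>.\<close>
  define k where "k = \<lfloor>\<alpha> / \<beta>\<rfloor>"
  define w where "w = \<epsilon> *\<^sub>R w0 + of_int k *\<^sub>R e"
  have w: "w \<in> int_lattice" "cross e w = \<epsilon>"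
    using w0 \<epsilon>(3) eL by (simp_all add: w_def int_lattice_closed cross_linear)
  define \<gamma> where "\<gamma> = \<alpha> - of_int k * \<beta>"
  have BV: "B - V = \<gamma> *\<^sub>R e + \<beta> *\<^sub>R w"
  proof -
    have "B - V = cross (B - V) w0 *\<^sub>R e + cross e (B - V) *\<^sub>R w0"
      using cross_expand[of e w0 "B - V"] w0 by simp
    moreover have "cross e (B - V) = \<beta> * \<epsilon>"
      unfolding \<beta>_def \<epsilon>_def by (simp add: abs_mult_sgn)
    ultimately show ?thesis by (simp add: w_def \<gamma>_def \<alpha>_def algebra_simps)
  qed
  have "of_int k \<le> \<alpha> / \<beta>" "\<alpha> / \<beta> < of_int k + 1" unfolding k_def by linarith+
  then have \<gamma>0: "0 \<le> \<gamma>" "\<gamma> < \<beta>" using \<beta> by (simp_all add: \<gamma>_def field_simps)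
  have "\<gamma> \<noteq> 0"
  proof
    assume "\<gamma> = 0"
    then have "w = (1 / \<beta>) *\<^sub>R (B - V)" using BV \<beta> by simp
    then show False using no_latt[of "1 / \<beta>" w] \<beta> w by simp
  qed
  then have \<gamma>: "0 < \<gamma>" using \<gamma>0 by simp
  define x where "x = \<beta> / \<gamma>"
  have x1: "1 < x" using \<gamma> \<gamma>0 by (simp add: x_def)
  have BVx: "B - V = \<gamma> *\<^sub>R (e + x *\<^sub>R w)" using BV \<gamma> by (simp add: x_def algebra_simps)
  have "x \<notin> \<rat>"
  proof
    assume "x \<in> \<rat>"
    then obtain r q where rq: "q > 0" "x = of_int r / of_int q" by (auto elim: Rats_cases')
    have "(of_int q / \<gamma>) *\<^sub>R (B - V) = of_int q *\<^sub>R e + of_int r *\<^sub>R w"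
      unfolding BVx using \<gamma> rq by (simp add: algebra_simps)
    moreover have "of_int q *\<^sub>R e + of_int r *\<^sub>R w \<in> int_lattice"
      using eL w by (simp add: int_lattice_closed)
    ultimately show False using no_latt[of "of_int q / \<gamma>"] rq(1) \<gamma> by simp
  qed
  define f where "f = (\<lambda>y :: real^2. (y $ 1 *\<^sub>R e + y $ 2 *\<^sub>R w) + V)"
  have f: "lattice_affine f" unfolding lattice_affine_altdef f_def
    using lattice_linear_basis[OF eL w(1)] w(2) \<epsilon>(2) V by blast
  have f0: "f 0 = V" by (simp add: f_def)
  have "f ` ray 0 (vector [1, 0]) = ray V (V + e)"
    by (simp add: lattice_affine_image_ray[OF f] f0) (simp add: f_def add.commute)
  also have "\<dots> = ray V A" unfolding AV using ray_scale[of "c / s" V e] e s by simp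
  finally have r1: "f ` ray 0 (vector [1, 0]) = ray V A" .
  have "f ` ray 0 (vector [1, x]) = ray V (V + (e + x *\<^sub>R w))"
    by (simp add: lattice_affine_image_ray[OF f] f0) (simp add: f_def add.commute)
  also have "\<dots> = ray V (V + (B - V))" unfolding BVx using ray_scale[OF \<gamma>] by simp
  finally have "f ` ray 0 (vector [1, x]) = ray V B" by simp
  then show ?thesis using that[OF x1 \<open>x \<notin> \<rat>\<close> f f0 r1] by blast
qed

lemma ltan_normal_form:
  assumes "1 < x" "x \<notin> \<rat>" "lattice_affine f" "f 0 = V"
    "f ` ray 0 (vector [1, 0]) = ray V A" "f ` ray 0 (vector [1, x]) = ray V B"
  shows "ltan A V B = x"
proof -
  obtain a t where "cfrac_expansion a t" "t 0 = x"
    using cfrac_expansion_of_irrational[OF assms(1,2)] by metis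
  then show ?thesis using cfrac_expansion.ltan_eq[of a t, OF _ assms(3,4,5)] assms(6) by simp
qed

lemma standard_angle:
  assumes "x \<notin> \<rat>" shows "R_irrational_angle (vector [1, 0]) 0 (vector [1, x])"
  unfolding R_irrational_angle_def
proof (intro conjI)
  have x0: "x \<noteq> 0" using assms by auto
  then show "\<not> collinear {0, vector [1, 0], vector [1, x] :: real^2}" by (simp add: collinear_iff_cross cross_def)
  show "0 \<in> int_lattice" by (rule int_lattice_closed)
  have "(vector [1, 0] :: real^2) \<in> open_ray 0 (vector [1, 0])"
    unfolding open_ray_def by (intro CollectI exI[of _ 1]) simp
  moreover have "(vector [1, 0] :: real^2) \<in> int_lattice" by (simp add: int_lattice_iff)
  ultimately show "open_ray 0 (vector [1, 0]) \<inter> int_lattice \<noteq> {}" by blast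
  show "open_ray 0 (vector [1, x]) \<inter> int_lattice = {}"
  proof (rule ccontr)
    assume "open_ray 0 (vector [1, x]) \<inter> int_lattice \<noteq> {}"
    then obtain s where s: "0 < s" "s \<in> \<int>" "s * x \<in> \<int>"
      by (auto simp: open_ray_def int_lattice_iff)
    have "s * x / s \<in> \<rat>" using s Ints_subset_Rats by (intro Rats_divide) auto
    then show False using s assms by simp
  qed
qed

lemma lattice_affine_id: "lattice_affine id"
proof -
  have "lattice_linear (\<lambda>x. x $ 1 *\<^sub>R vector [1, 0] + x $ 2 *\<^sub>R vector [0, 1])"
    by (rule lattice_linear_basis) (simp_all add: int_lattice_iff cross_def)
  moreover have "id = (\<lambda>x :: real^2. x $ 1 *\<^sub>R vector [1, 0] + x $ 2 *\<^sub>R vector [0, 1] + 0)"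
    by (simp add: fun_eq_iff vec2_eq_iff)
  ultimately show ?thesis unfolding lattice_affine_altdef using int_lattice_closed(1) by blast
qed

text \<open>Invariance of \<open>ltan\<close> needs no computation of its own: following the normal
  form of the first angle by the congruence gives a normal form of the second with the same
  \<open>x\<close>.\<close>

lemma lattice_congruent_iff_ltan:
  assumes "R_irrational_angle A V B" "R_irrational_angle A' V' B'"
  shows "lattice_congruent A V B A' V' B' \<longleftrightarrow> ltan A V B = ltan A' V' B'"
proof -
  obtain f x where f: "1 < x" "x \<notin> \<rat>" "lattice_affine f" "f 0 = V"
    "f ` ray 0 (vector [1, 0]) = ray V A" "f ` ray 0 (vector [1, x]) = ray V B"
    using angle_normal_form[OF assms(1)] by metis
  obtain f' x' where f': "1 < x'" "x' \<notin> \<rat>" "lattice_affine f'" "f' 0 = V'"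
    "f' ` ray 0 (vector [1, 0]) = ray V' A'" "f' ` ray 0 (vector [1, x']) = ray V' B'"
    using angle_normal_form[OF assms(2)] by metis
  have ltan: "ltan A V B = x" "ltan A' V' B' = x'"
    using ltan_normal_form[OF f] ltan_normal_form[OF f'] by auto
  show ?thesis
  proof
    assume "lattice_congruent A V B A' V' B'"
    then obtain g where g: "lattice_affine g" "g V = V'"
      "g ` ray V A = ray V' A'" "g ` ray V B = ray V' B'"
      unfolding lattice_congruent_def by blast
    have "ltan A' V' B' = x"
    proof (rule ltan_normal_form[OF f(1,2)])
      show "lattice_affine (g \<circ> f)" using lattice_affine_comp[OF g(1) f(3)] .
      show "(g \<circ> f) 0 = V'" using f(4) g(2) by simp
      show "(g \<circ> f) ` ray 0 (vector [1, 0]) = ray V' A'" "(g \<circ> f) ` ray 0 (vector [1, x]) = ray V' B'"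
        unfolding image_comp[symmetric] f(5,6) g(3,4) by (rule refl)+
    qed
    then show "ltan A V B = ltan A' V' B'" using ltan by simp
  next
    assume "ltan A V B = ltan A' V' B'"
    then have "x' = x" using ltan by simp
    obtain g where g: "lattice_affine g" "\<And>y. f (g y) = y" "\<And>y. g (f y) = y"
      using lattice_affine_inverse[OF f(3)] by metis
    have gf: "g ` f ` S = S" for S using g(3) by (simp add: image_image)
    show "lattice_congruent A V B A' V' B'" unfolding lattice_congruent_def
    proof (intro exI conjI)
      show "lattice_affine (f' \<circ> g)" using lattice_affine_comp[OF f'(3) g(1)] .
      show "(f' \<circ> g) V = V'" using f(4) f'(4) g(3) by auto
      show "(f' \<circ> g) ` ray V A = ray V' A'" "(f' \<circ> g) ` ray V B = ray V' B'"
        unfolding f(5,6)[symmetric] image_comp[symmetric] gf using f'(5,6) \<open>x' = x\<close> by simp_all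
    qed
  qed
qed

theorem theorem5p10:
  "(\<forall>a :: nat \<Rightarrow> nat. (\<forall>n. 0 < a n) \<longrightarrow>
      (\<exists>A V B. R_irrational_angle A V B \<and> ltan A V B = inf_cfrac (\<lambda>n. real (a n)))) \<and>
   (\<forall>A V B A' V' B'. R_irrational_angle A V B \<longrightarrow> R_irrational_angle A' V' B' \<longrightarrow>
      (lattice_congruent A V B A' V' B' \<longleftrightarrow> ltan A V B = ltan A' V' B'))"
proof (intro conjI allI impI)
  fix a :: "nat \<Rightarrow> nat" assume a: "\<forall>n. 0 < a n"
  \<comment> \<open>The complete quotients are the values of the tails; the one of index 0 is the
    prescribed continued fraction, which thus exceeds 1 and is irrational.\<close>
  interpret cfrac_expansion a "\<lambda>n. inf_cfrac (\<lambda>i. real (a (n + i)))"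
    using a by (intro cfrac_expansion_of_seq) auto
  define x where "x = inf_cfrac (\<lambda>n. real (a n))"
  have x: "1 < x" "x \<notin> \<rat>" using t_gt_1[of 0] irrational by (simp_all add: x_def)
  have "ltan (vector [1, 0]) 0 (vector [1, x]) = x"
    by (rule ltan_normal_form[OF x lattice_affine_id]) simp_all
  then show "\<exists>A V B. R_irrational_angle A V B \<and> ltan A V B = inf_cfrac (\<lambda>n. real (a n))"
    using standard_angle[OF x(2)] unfolding x_def by blast
next
  fix A V B A' V' B'
  assume "R_irrational_angle A V B" "R_irrational_angle A' V' B'"
  then show "lattice_congruent A V B A' V' B' \<longleftrightarrow> ltan A V B = ltan A' V' B'"
    by (rule lattice_congruent_iff_ltan)
qed

end
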